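(* Let $s \ge 3$ and suppose there exist an $(n, d(F), \lambda(F))$-graph $F$ and an $(n, d(G), \lambda(G))$-graph $G$ on the same vertex set $V$ such that the pair $(F,G)$ is $H_s$-free. Let \[ \eta = \max\left\{ \frac{\lambda(G)^2}{d(G)^2}, \frac{\lambda(F)\lambda(G)}{d(F)d(G)} \right\}, \qquad w = \frac{4 n \log n}{d(G)}. \] Then for every positive integer $k$ with $w \le k \le \eta\, d(F)\, n$, \[ r(s,k) \ge \frac{1}{50} k\, \eta^{\frac{w-k}{k}} - 1. \] In particular, if $\eta\, d(F)\, n \ge k \ge 100 n (\log n)^2 / d(G)$, then \[ r(s,k) \ge \frac{k}{100\eta} - 1. \]
   Context: Graphs may have loops (at most one per vertex); in the adjacency matrix a loop is a $1$ on the diagonal and contributes one to the degree. A graph is an $(n,d,\lambda)$-graph if it has $n$ vertices, is $d$-regular, and all eigenvalues of its adjacency matrix other than the largest one (which equals $d$) are at most $\lambda$ in absolute value. An ordered pair of graphs $(F,G)$ on the same vertex set is $H_s$-free if there is no $2s$-tuple of (not necessarily distinct) vertices $(a_1,b_1,\dots,a_s,b_s)$ with $a_ib_i \in E(F)$ for all $i\in[s]$ and $a_ib_j \in E(G)$ for all $1 \le i < j \le s$ (an edge $aa$ means a loop). The Ramsey number $r(s,k)$ is the minimum $N$ such that every graph on $N$ vertices contains a clique of size $s$ or an independent set of size $k$. $\log$ is the natural logarithm. *)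

theory Defs
  imports Complex_Main "Jordan_Normal_Form.Char_Poly" "HOL-Computational_Algebra.Polynomial"
begin

text \<open>A graph (loops allowed, at most one per vertex) on the vertex set V is given by a
  symmetric edge relation E whose edges lie inside V; E v v means a loop at v.\<close>
definition is_graph :: "'a set \<Rightarrow> ('a \<Rightarrow> 'a \<Rightarrow> bool) \<Rightarrow> bool" where
  "is_graph V E \<longleftrightarrow> finite V \<and> (\<forall>u v. E u v \<longrightarrow> u \<in> V \<and> v \<in> V) \<and> (\<forall>u v. E u v \<longrightarrow> E v u)"

text \<open>Degree: a loop contributes one.\<close>
definition degree :: "'a set \<Rightarrow> ('a \<Rightarrow> 'a \<Rightarrow> bool) \<Rightarrow> 'a \<Rightarrow> nat" where
  "degree V E v = card {u \<in> V. E v u}"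

text \<open>Adjacency matrix with respect to a (fixed, arbitrary) enumeration of V; its spectrum
  does not depend on the enumeration.\<close>
definition adj_mat :: "'a set \<Rightarrow> ('a \<Rightarrow> 'a \<Rightarrow> bool) \<Rightarrow> real mat" where
  "adj_mat V E = (let n = card V; f = (SOME f. bij_betw f {..<n} V)
     in mat n n (\<lambda>(i, j). if E (f i) (f j) then 1 else 0))"

definition adj_eigenvalues :: "'a set \<Rightarrow> ('a \<Rightarrow> 'a \<Rightarrow> bool) \<Rightarrow> real multiset" where
  "adj_eigenvalues V E = proots (char_poly (adj_mat V E))"

definition ndl_graph :: "'a set \<Rightarrow> ('a \<Rightarrow> 'a \<Rightarrow> bool) \<Rightarrow> nat \<Rightarrow> nat \<Rightarrow> real \<Rightarrow> bool" where
  "ndl_graph V E n d lam \<longleftrightarrow> is_graph V E \<and> card V = n \<and> (\<forall>v\<in>V. degree V E v = d) \<and>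
     (let M = adj_eigenvalues V E in
        Max (set_mset M) = real d \<and>
        (\<forall>\<mu> \<in># M - {# Max (set_mset M) #}. \<bar>\<mu>\<bar> \<le> lam))"

definition Hs_free :: "nat \<Rightarrow> 'a set \<Rightarrow> ('a \<Rightarrow> 'a \<Rightarrow> bool) \<Rightarrow> ('a \<Rightarrow> 'a \<Rightarrow> bool) \<Rightarrow> bool" where
  "Hs_free s V F G \<longleftrightarrow> \<not> (\<exists>a b :: nat \<Rightarrow> 'a.
      (\<forall>i\<in>{1..s}. a i \<in> V \<and> b i \<in> V) \<and>
      (\<forall>i\<in>{1..s}. F (a i) (b i)) \<and>
      (\<forall>i\<in>{1..s}. \<forall>j\<in>{1..s}. i < j \<longrightarrow> G (a i) (b j)))"

definition ramsey_prop :: "nat \<Rightarrow> nat \<Rightarrow> nat \<Rightarrow> bool" where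
  "ramsey_prop s k N \<longleftrightarrow> (\<forall>E :: nat \<Rightarrow> nat \<Rightarrow> bool. (\<forall>u v. E u v \<longrightarrow> E v u) \<longrightarrow>
      (\<exists>S \<subseteq> {..<N}. card S = s \<and> (\<forall>x\<in>S. \<forall>y\<in>S. x \<noteq> y \<longrightarrow> E x y)) \<or>
      (\<exists>S \<subseteq> {..<N}. card S = k \<and> (\<forall>x\<in>S. \<forall>y\<in>S. x \<noteq> y \<longrightarrow> \<not> E x y)))"

definition ramsey_number :: "nat \<Rightarrow> nat \<Rightarrow> nat" where
  "ramsey_number s k = (LEAST N. ramsey_prop s k N)"

end

theory Submission
  imports Defs "Jordan_Normal_Form.Schur_Decomposition" "HOL-Analysis.Convex"
    "HOL-Library.Ramsey" "HOL-Library.FuncSet"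
begin

text \<open>Put \<open>M = \<lfloor>k \<eta>\<^bsup>(w - k) / k\<^esup> / 50\<rfloor>\<close> and choose pairs \<open>(a\<^sub>i, b\<^sub>i)\<close>, \<open>i < M\<close>, independently and
  uniformly among the \<open>n d(F)\<close> ordered edges of \<open>F\<close>. Join \<open>i < j\<close> when \<open>a\<^sub>i b\<^sub>j\<close> is an edge of \<open>G\<close>; an
  \<open>s\<close>-clique would be a copy of \<open>H\<^sub>s\<close>. The expected number of independent \<open>k\<close>-sets is \<open>M choose k\<close> times
  the proportion of \<open>k\<close>-tuples of \<open>F\<close>-edges without \<open>G\<close>-edges \<open>a\<^sub>i b\<^sub>j\<close>, \<open>i < j\<close>. To count those tuples,
  choose the pairs from the last to the first and let \<open>A\<close> be the set of vertices that are still allowed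
  as \<open>a\<^sub>i\<close>. By the expander mixing lemma for \<open>G\<close> and \<open>F\<close>, all but \<open>6 \<eta> n d(F)\<close> choices remove at least
  a fraction \<open>d(G) / (2 n)\<close> of \<open>A\<close>, which can happen at most \<open>w\<close> times.

  The mixing lemma only needs \<open>\<parallel>A x\<parallel> \<le> \<lambda> \<parallel>x\<parallel>\<close> for \<open>x\<close> orthogonal to the constants, which follows from
  \<open>tr(A\<^bsup>2m\<^esup>) \<le> d\<^bsup>2m\<^esup> + n \<lambda>\<^bsup>2m\<^esup>\<close> as \<open>m\<close> tends to infinity.\<close>

section \<open>Spectra and traces of powers of real symmetric matrices\<close>

text \<open>For an eigenvector \<open>v\<close>, the form \<open>S\<close> = v* A v equals its own
  conjugate by symmetry of \<open>A\<close>, and it also equals \<open>z\<close> times the positive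
  number \<open>r\<close>.\<close>

lemma real_symmetric_eigenvalue_real:
  fixes A :: "real mat"
  assumes A: "A \<in> carrier_mat n n"
    and sym: "\<And>i j. i < n \<Longrightarrow> j < n \<Longrightarrow> A $$ (i,j) = A $$ (j,i)"
    and ev: "eigenvalue (map_mat complex_of_real A) z"
  shows "complex_of_real (Re z) = z"
proof -
  obtain v where v: "v \<in> carrier_vec n" "v \<noteq> 0\<^sub>v n"
    and Av: "map_mat complex_of_real A *\<^sub>v v = z \<cdot>\<^sub>v v"
    using ev A unfolding eigenvalue_def eigenvector_def by auto
  define S where "S = (\<Sum>i<n. \<Sum>j<n. cnj (v $ i) * (complex_of_real (A $$ (i,j)) * v $ j))"
  define r where "r = (\<Sum>i<n. (cmod (v $ i))\<^sup>2)"
  have row: "(\<Sum>j<n. complex_of_real (A $$ (i,j)) * v $ j) = z * v $ i" if "i < n" for i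
  proof -
    have "(map_mat complex_of_real A *\<^sub>v v) $ i = (z \<cdot>\<^sub>v v) $ i" using Av by simp
    thus ?thesis using that v A
      by (simp add: scalar_prod_def atLeast0LessThan)
  qed
  have "S = (\<Sum>i<n. cnj (v $ i) * (z * v $ i))"
    unfolding S_def by (simp add: sum_distrib_left[symmetric] row)
  also have "\<dots> = z * of_real r"
    by (simp add: r_def sum_distrib_left complex_norm_square ac_simps of_real_power[symmetric] del: of_real_power)
  finally have S: "S = z * of_real r" .
  have "cnj S = (\<Sum>i<n. \<Sum>j<n. v $ i * (complex_of_real (A $$ (i,j)) * cnj (v $ j)))"
    by (simp add: S_def)
  also have "\<dots> = (\<Sum>j<n. \<Sum>i<n. v $ i * (complex_of_real (A $$ (i,j)) * cnj (v $ j)))"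
    by (rule sum.swap)
  also have "\<dots> = S"
    unfolding S_def by (intro sum.cong refl) (simp add: sym ac_simps)
  finally have cS: "cnj S = S" .
  obtain i where i: "i < n" "v $ i \<noteq> 0" using v by (metis eq_vecI carrier_vecD index_zero_vec)
  have "0 < r" unfolding r_def by (rule sum_pos2[of _ i]) (use i in auto)
  moreover have "cnj z * of_real r = z * of_real r" using cS S by simp
  ultimately have "cnj z = z" by simp
  thus ?thesis by (simp add: complex_eq_iff)
qed

text \<open>The characteristic polynomial splits over the complex numbers. Every root is an
  eigenvalue and hence real, so the factorization pulls back along the injective embedding of the
  reals.\<close>

lemma real_symmetric_char_poly_splits:
  fixes A :: "real mat"
  assumes A: "A \<in> carrier_mat n n"
    and sym: "\<And>i j. i < n \<Longrightarrow> j < n \<Longrightarrow> A $$ (i,j) = A $$ (j,i)"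
  obtains es where "char_poly A = (\<Prod>e\<leftarrow>es. [:- e, 1:])" "length es = n"
proof -
  let ?C = "map_mat complex_of_real A"
  have C: "?C \<in> carrier_mat n n" using A by simp
  obtain as where as: "char_poly ?C = (\<Prod>a\<leftarrow>as. [:- a, 1:])" "length as = n"
    using char_poly_factorized[OF C] by blast
  have real: "complex_of_real (Re a) = a" if "a \<in> set as" for a
  proof (rule real_symmetric_eigenvalue_real[OF A sym])
    show "eigenvalue ?C a"
      unfolding eigenvalue_root_char_poly[OF C] as(1) using that
      by (auto simp: poly_prod_list prod_list_zero_iff)
  qed
  interpret h: map_poly_inj_comm_ring_hom complex_of_real ..
  have "map_poly complex_of_real (char_poly A) = (\<Prod>a\<leftarrow>as. [:- a, 1:])"
    using of_real_hom.char_poly_hom[OF A] as by metis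
  also have "\<dots> = (\<Prod>a\<leftarrow>as. map_poly complex_of_real [:- Re a, 1:])"
    by (intro arg_cong[of _ _ prod_list] map_cong) (auto simp: real)
  also have "\<dots> = map_poly complex_of_real (\<Prod>e\<leftarrow>map Re as. [:- e, 1:])"
    by (simp add: h.hom_prod_list o_def)
  finally show thesis using as by (intro that[of "map Re as"]) auto
qed

lemma upper_triangular_mult:
  fixes A B :: "'b::comm_ring_1 mat"
  assumes A: "A \<in> carrier_mat n n" "upper_triangular A"
    and B: "B \<in> carrier_mat n n" "upper_triangular B"
  shows "upper_triangular (A * B)" and "\<And>i. i < n \<Longrightarrow> (A * B) $$ (i,i) = A $$ (i,i) * B $$ (i,i)"
proof -
  have e: "(A * B) $$ (i,j) = (\<Sum>l<n. A $$ (i,l) * B $$ (l,j))" if "i < n" "j < n" for i j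
    using that A B by (simp add: scalar_prod_def atLeast0LessThan)
  have z: "A $$ (i,l) * B $$ (l,j) = 0" if "i < n" "l < n" "l < i \<or> j < l" for i j l
    using that A B by (auto dest: upper_triangularD)
  show "upper_triangular (A * B)"
  proof
    fix i j assume "j < i" "i < dim_row (A * B)"
    moreover from this A have "i < n" "j < n" by auto
    ultimately show "(A * B) $$ (i,j) = 0"
      by (subst e) (auto intro!: sum.neutral z)
  qed
  fix i assume i: "i < n"
  have "(\<Sum>l<n. A $$ (i,l) * B $$ (l,i)) = (\<Sum>l\<in>{i}. A $$ (i,l) * B $$ (l,i))"
    using i by (intro sum.mono_neutral_right) (auto intro!: z)
  thus "(A * B) $$ (i,i) = A $$ (i,i) * B $$ (i,i)" using i by (simp add: e)
qed

lemma upper_triangular_pow: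
  fixes A :: "'b::comm_ring_1 mat"
  assumes A: "A \<in> carrier_mat n n" "upper_triangular A"
  shows "upper_triangular (A ^\<^sub>m m) \<and> (\<forall>i<n. (A ^\<^sub>m m) $$ (i,i) = (A $$ (i,i)) ^ m)"
proof (induction m)
  case 0
  show ?case using A by auto
next
  case (Suc m)
  thus ?case using upper_triangular_mult[of "A ^\<^sub>m m" n A] A by (auto simp: ac_simps)
qed

lemma trace_mult_commute:
  fixes A B :: "'b::comm_ring_1 mat"
  assumes "A \<in> carrier_mat n n" "B \<in> carrier_mat n n"
  shows "(\<Sum>i<n. (A * B) $$ (i,i)) = (\<Sum>i<n. (B * A) $$ (i,i))"
proof -
  have "(\<Sum>i<n. (A * B) $$ (i,i)) = (\<Sum>i<n. \<Sum>l<n. A $$ (i,l) * B $$ (l,i))"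
    using assms by (simp add: scalar_prod_def atLeast0LessThan)
  also have "\<dots> = (\<Sum>l<n. \<Sum>i<n. A $$ (i,l) * B $$ (l,i))" by (rule sum.swap)
  also have "\<dots> = (\<Sum>i<n. (B * A) $$ (i,i))"
    using assms by (simp add: scalar_prod_def atLeast0LessThan ac_simps)
  finally show ?thesis .
qed

text \<open>By Schur, \<open>A\<close> is similar to an upper triangular \<open>B\<close> with
  diagonal \<open>es\<close>. The trace is invariant under cyclic shifts, and powers of
  \<open>B\<close> have the powers of its diagonal entries on the diagonal.\<close>

lemma trace_pow_eigenvalues:
  fixes A :: "'b::conjugatable_ordered_field mat"
  assumes A: "A \<in> carrier_mat n n" and cp: "char_poly A = (\<Prod>e\<leftarrow>es. [:- e, 1:])"
  shows "(\<Sum>i<n. (A ^\<^sub>m m) $$ (i,i)) = (\<Sum>e\<leftarrow>es. e ^ m)"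
proof -
  obtain B P Q where "schur_decomposition A es = (B,P,Q)" by (cases "schur_decomposition A es")
  from schur_decomposition[OF A cp this]
  have sim: "similar_mat_wit A B P Q" and ut: "upper_triangular B" and diag: "diag_mat B = es" by auto
  note wit = similar_mat_witD2[OF A sim]
  note pw = upper_triangular_pow[OF wit(5) ut, of m]
  have Bm: "B ^\<^sub>m m \<in> carrier_mat n n" using wit by simp
  have "(\<Sum>i<n. (A ^\<^sub>m m) $$ (i,i)) = (\<Sum>i<n. (P * (B ^\<^sub>m m * Q)) $$ (i,i))"
    using similar_mat_wit_pow_id[OF sim, of m] assoc_mult_mat[OF wit(6) Bm wit(7)] by simp
  also have "\<dots> = (\<Sum>i<n. ((B ^\<^sub>m m * Q) * P) $$ (i,i))"
    by (rule trace_mult_commute[OF wit(6) mult_carrier_mat[OF Bm wit(7)]])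
  also have "(B ^\<^sub>m m * Q) * P = B ^\<^sub>m m"
    using assoc_mult_mat[OF Bm wit(7) wit(6)] wit(2) right_mult_one_mat[OF Bm] by simp
  also have "(\<Sum>i<n. (B ^\<^sub>m m) $$ (i,i)) = (\<Sum>i<n. (B $$ (i,i)) ^ m)" using pw by auto
  also have "\<dots> = (\<Sum>e\<leftarrow>diag_mat B. e ^ m)"
    using wit(5) by (simp add: diag_mat_def sum_list_distinct_conv_sum_set o_def atLeast0LessThan)
  finally show ?thesis using diag by simp
qed

text \<open>Turns the list of eigenvalues into the multiset of \<open>adj_eigenvalues\<close>, with
  multiplicities.\<close>

lemma proots_prod_linear: "proots (\<Prod>e\<leftarrow>es. [:- e, 1:]) = mset (es :: 'b::idom list)"
proof (induction es)
  case (Cons e es)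
  have "(\<Prod>e\<leftarrow>es. [:- e, 1:]) \<noteq> 0" by (auto simp: prod_list_zero_iff)
  hence "proots ([:- e, 1:] * (\<Prod>e\<leftarrow>es. [:- e, 1:])) = proots [:- e, 1:] + mset es"
    by (subst proots_mult) (auto simp: Cons)
  thus ?case by simp
qed simp

section \<open>From traces of even powers to a norm bound on vectors of sum zero\<close>

text \<open>If 0 < \<open>v\<close> < \<open>u\<close>, the powers of \<open>u / v\<close> exceed
  any constant \<open>c\<close>, and the exponents 2^k are cofinal.\<close>

lemma le_of_power_le_const_mult_power:
  fixes u v c :: real
  assumes "0 \<le> u" "0 \<le> v" and le: "\<And>k. u ^ (2 ^ k) \<le> c * v ^ (2 ^ k)"
  shows "u \<le> v"
proof (rule ccontr)
  assume "\<not> u \<le> v"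
  hence uv: "v < u" by simp
  show False
  proof (cases "v = 0")
    case True
    thus False using le[of 0] uv by simp
  next
    case False
    hence v: "0 < v" using assms by simp
    hence "1 < u / v" using uv by simp
    then obtain m where m: "c < (u / v) ^ m" using real_arch_pow by blast
    have "m \<le> 2 ^ m" by (simp add: less_imp_le)
    hence "(u / v) ^ m \<le> (u / v) ^ (2 ^ m)" using \<open>1 < u / v\<close> by (intro power_increasing) auto
    also have "\<dots> \<le> c" using le[of m] v by (simp add: power_divide field_simps)
    finally show False using m by simp
  qed
qed

text \<open>The squared norm \<open>q m\<close> of \<open>A\<^sup>m x\<close> satisfies \<open>(q m)\<^sup>2 \<le> q 0 * q (2 * m)\<close>, so a bound on the growth
  of \<open>q\<close> along powers of two, however weak its constant, gives the sharp bound on \<open>q 1\<close>.\<close>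
lemma trace_bound_imp_norm_bound:
  fixes a :: "nat \<Rightarrow> nat \<Rightarrow> nat \<Rightarrow> real" and d lam :: real
  assumes add: "\<And>m m' i j. i < n \<Longrightarrow> j < n \<Longrightarrow> a (m + m') i j = (\<Sum>l<n. a m i l * a m' l j)"
    and one: "\<And>i j. i < n \<Longrightarrow> j < n \<Longrightarrow> a 0 i j = (if i = j then 1 else 0)"
    and sym: "\<And>m i j. i < n \<Longrightarrow> j < n \<Longrightarrow> a m i j = a m j i"
    and row: "\<And>m i. i < n \<Longrightarrow> (\<Sum>j<n. a m i j) = d ^ m"
    and tr: "\<And>m. (\<Sum>i<n. a (2 * m) i i) \<le> d ^ (2 * m) + n * lam ^ (2 * m)"
    and x: "(\<Sum>j<n. x j) = 0"
  shows "(\<Sum>i<n. (\<Sum>j<n. a 1 i j * x j)\<^sup>2) \<le> lam\<^sup>2 * (\<Sum>j<n. (x j)\<^sup>2)"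
proof (cases "n = 0")
  case False
  define y where "y m i = (\<Sum>j<n. a m i j * x j)" for m i
  define q where "q m = (\<Sum>i<n. (y m i)\<^sup>2)" for m
  have q_nonneg: "0 \<le> q m" for m by (simp add: q_def sum_nonneg)
  have y0: "y 0 i = x i" if "i < n" for i
  proof -
    have "y 0 i = (\<Sum>j<n. if i = j then x j else 0)"
      unfolding y_def using that by (intro sum.cong) (auto simp: one)
    thus ?thesis using that by simp
  qed
  have q0: "q 0 = (\<Sum>j<n. (x j)\<^sup>2)" unfolding q_def by (simp add: y0)
  \<comment> \<open>By symmetry the squared norm of A^m x is the inner product of x and A^(2m) x;
    then Cauchy-Schwarz.\<close>
  have conv: "(q m)\<^sup>2 \<le> q 0 * q (2 * m)" for m
  proof -
    have "q m = (\<Sum>i<n. \<Sum>j<n. y m i * (a m i j * x j))"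
      unfolding q_def power2_eq_square by (subst (2) y_def) (simp add: sum_distrib_left)
    also have "\<dots> = (\<Sum>j<n. \<Sum>i<n. y m i * (a m i j * x j))" by (rule sum.swap)
    also have "\<dots> = (\<Sum>j<n. x j * y (2 * m) j)"
    proof (intro sum.cong refl)
      fix j assume j: "j \<in> {..<n}"
      have "y (2 * m) j = (\<Sum>l<n. (\<Sum>i<n. a m j i * a m i l) * x l)"
        unfolding y_def mult_2 using j by (simp add: add)
      also have "\<dots> = (\<Sum>l<n. \<Sum>i<n. a m j i * (a m i l * x l))"
        by (simp add: sum_distrib_right mult.assoc)
      also have "\<dots> = (\<Sum>i<n. \<Sum>l<n. a m j i * (a m i l * x l))" by (rule sum.swap)
      also have "\<dots> = (\<Sum>i<n. a m i j * y m i)"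
        unfolding y_def using j by (simp add: sum_distrib_left sym[of j])
      finally show "(\<Sum>i<n. y m i * (a m i j * x j)) = x j * y (2 * m) j"
        by (simp add: sum_distrib_left ac_simps)
    qed
    finally show ?thesis
      using Cauchy_Schwarz_ineq_sum[of x "y (2 * m)" "{..<n}"] q0 by (simp add: q_def)
  qed
  \<comment> \<open>Subtracting \<open>d ^ m / n\<close> from every entry removes the contribution
    of the constant vector and changes nothing on \<open>x\<close>, whose sum is 0. The squared
    Frobenius norm of the remainder \<open>b\<close> is tr(A^(2m)) - d^(2m), which the trace
    hypothesis bounds.\<close>
  have growth: "q m \<le> q 0 * (n * lam ^ (2 * m))" for m
  proof -
    define b where "b i j = a m i j - d ^ m / n" for i j
    have yb: "y m i = (\<Sum>j<n. b i j * x j)" for i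
    proof -
    have "(\<Sum>j<n. d ^ m / n * x j) = 0" unfolding sum_distrib_left[symmetric] using x by simp
    thus ?thesis unfolding y_def b_def left_diff_distrib sum_subtractf by simp
  qed
    have "q m \<le> (\<Sum>i<n. (\<Sum>j<n. (b i j)\<^sup>2) * q 0)"
      unfolding q_def[of m] yb q0 by (intro sum_mono Cauchy_Schwarz_ineq_sum)
    also have "\<dots> = q 0 * (\<Sum>i<n. \<Sum>j<n. (b i j)\<^sup>2)"
      by (simp add: sum_distrib_left ac_simps)
    also have "(\<Sum>i<n. \<Sum>j<n. (b i j)\<^sup>2) = (\<Sum>i<n. a (2 * m) i i - d ^ (2 * m) / n)"
    proof (intro sum.cong refl)
      fix i assume i: "i \<in> {..<n}"
      have d2: "d ^ (2 * m) = d ^ m * d ^ m" by (simp add: mult_2 power_add)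
      have "(b i j)\<^sup>2 = a m i j * a m i j - a m i j * (2 * (d ^ m / n)) + (d ^ m / n)\<^sup>2" for j
        unfolding b_def power2_diff by (simp add: power2_eq_square)
      hence "(\<Sum>j<n. (b i j)\<^sup>2)
          = (\<Sum>j<n. a m i j * a m i j) - (\<Sum>j<n. a m i j) * (2 * (d ^ m / n)) + n * (d ^ m / n)\<^sup>2"
        unfolding sum_distrib_right by (simp only: sum.distrib sum_subtractf sum_constant card_lessThan)
      also have "(\<Sum>j<n. a m i j * a m i j) = (\<Sum>j<n. a m i j * a m j i)"
        using i by (intro sum.cong refl) (simp add: sym[of i])
      also have "\<dots> = a (2 * m) i i"
        unfolding mult_2 using i by (simp only: add lessThan_iff)
      also have "(\<Sum>j<n. a m i j) = d ^ m" using i row by simp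
      also have "a (2 * m) i i - d ^ m * (2 * (d ^ m / n)) + n * (d ^ m / n)\<^sup>2 = a (2 * m) i i - d ^ (2 * m) / n"
        using False unfolding d2 by (simp add: power2_eq_square)
      finally show "(\<Sum>j<n. (b i j)\<^sup>2) = a (2 * m) i i - d ^ (2 * m) / n" .
    qed
    also have "\<dots> \<le> n * lam ^ (2 * m)" using tr[of m] False by (simp add: sum_subtractf)
    finally show ?thesis using q_nonneg[of 0] by (simp add: mult_left_mono)
  qed
  \<comment> \<open>Iterates \<open>conv\<close> by doubling: squaring the bound for
    \<open>k\<close> turns the exponent 2^k - 1 of \<open>q 0\<close> into 2^(k+1) - 2, and
    \<open>conv\<close> adds one more factor.\<close>
  have log_convex: "q 1 ^ (2 ^ k) \<le> q 0 ^ (2 ^ k - 1) * q (2 ^ k)" for k :: nat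
  proof (induction k)
    case (Suc k)
    have "q 1 ^ (2 ^ Suc k) = (q 1 ^ (2 ^ k))\<^sup>2" by (simp add: power_mult[symmetric] ac_simps)
    also have "\<dots> \<le> (q 0 ^ (2 ^ k - 1) * q (2 ^ k))\<^sup>2"
      by (intro power_mono Suc) (simp add: q_nonneg)
    also have "\<dots> = q 0 ^ (2 * (2 ^ k - 1)) * (q (2 ^ k))\<^sup>2"
      by (simp add: power_mult_distrib power_mult[symmetric] ac_simps)
    also have "\<dots> \<le> q 0 ^ (2 * (2 ^ k - 1)) * (q 0 * q (2 ^ Suc k))"
      using conv[of "2 ^ k"] by (intro mult_left_mono) (simp_all add: q_nonneg)
    also have "\<dots> = q 0 ^ Suc (2 * (2 ^ k - 1)) * q (2 ^ Suc k)" by simp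
    also have "Suc (2 * (2 ^ k - 1)) = 2 ^ Suc k - (1::nat)"
    proof -
      have "(1::nat) \<le> 2 ^ k" by simp
      thus ?thesis unfolding power_Suc by arith
    qed
    finally show ?case .
  qed simp
  \<comment> \<open>The factor \<open>n\<close> does not depend on \<open>k\<close>, so it
    disappears in the limit.\<close>
  have pow: "q 1 ^ (2 ^ k) \<le> n * (lam\<^sup>2 * q 0) ^ (2 ^ k)" for k :: nat
  proof -
    have "q 1 ^ (2 ^ k) \<le> q 0 ^ (2 ^ k - 1) * q (2 ^ k)" by (rule log_convex)
    also have "\<dots> \<le> q 0 ^ (2 ^ k - 1) * (q 0 * (n * lam ^ (2 * 2 ^ k)))"
      by (intro mult_left_mono growth) (simp add: q_nonneg)
    also have "\<dots> = n * ((q 0 ^ (2 ^ k - 1) * q 0) * (lam\<^sup>2) ^ 2 ^ k)"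
      by (simp only: power_mult ac_simps)
    also have "q 0 ^ (2 ^ k - 1) * q 0 = q 0 ^ 2 ^ k" by (rule power_minus_mult) simp
    finally show ?thesis by (simp add: power_mult_distrib ac_simps)
  qed
  have "q 1 \<le> lam\<^sup>2 * q 0"
    using q_nonneg[of 1] mult_nonneg_nonneg[OF zero_le_power2 q_nonneg] pow
    by (rule le_of_power_le_const_mult_power)
  thus ?thesis unfolding q0 unfolding q_def y_def .
qed simp

section \<open>Norm bound and expander mixing lemma for graphs\<close>

lemma pow_mat_add:
  fixes A :: "'b::semiring_1 mat"
  assumes A: "A \<in> carrier_mat n n"
  shows "A ^\<^sub>m (m + m') = A ^\<^sub>m m * A ^\<^sub>m m'"
proof (induction m')
  case (Suc m')
  thus ?case
    using assoc_mult_mat[OF pow_carrier_mat[OF A, of m] pow_carrier_mat[OF A, of m'] A] by simp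
qed (use right_mult_one_mat[OF pow_carrier_mat[OF A, of m]] A in simp)

text \<open>Gives access to the spectrum: a concrete enumeration \<open>f\<close> of the vertices
  and the multiset \<open>R\<close> of the eigenvalues other than one copy of
  \<open>d\<close>.\<close>

lemma ndl_graph_adj_eigenvalues:
  assumes ndl: "ndl_graph V E n d lam" and n: "0 < n"
  obtains f R where "bij_betw f {..<n} V"
    and "adj_mat V E = mat n n (\<lambda>(i, j). of_bool (E (f i) (f j)))"
    and "\<And>m. (\<Sum>i<n. (adj_mat V E ^\<^sub>m m) $$ (i,i)) = real d ^ m + (\<Sum>e\<in>#R. e ^ m)"
    and "\<And>e. e \<in># R \<Longrightarrow> \<bar>e\<bar> \<le> lam" and "Suc (size R) = n"
proof -
  have fin: "finite V" and V: "card V = n" and E_sym: "\<And>u v. E u v \<longleftrightarrow> E v u"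
    using ndl by (auto simp: ndl_graph_def is_graph_def)
  define f where "f = (SOME f. bij_betw f {..<n} V)"
  have "\<exists>f. bij_betw f {..<n} V" 
    using ex_bij_betw_nat_finite[OF fin] V by (simp add: atLeast0LessThan)
  hence f: "bij_betw f {..<n} V" unfolding f_def by (rule someI_ex)
  have M: "adj_mat V E = mat n n (\<lambda>(i, j). of_bool (E (f i) (f j)))"
    unfolding adj_mat_def f_def V Let_def by (simp add: of_bool_def)
  hence carr: "adj_mat V E \<in> carrier_mat n n" by simp
  obtain es where es: "char_poly (adj_mat V E) = (\<Prod>e\<leftarrow>es. [:- e, 1:])" "length es = n"
    by (rule real_symmetric_char_poly_splits[OF carr]) (auto simp: M E_sym)
  have ev: "adj_eigenvalues V E = mset es"
    unfolding adj_eigenvalues_def es(1) by (rule proots_prod_linear)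
  have "Max (set es) = real d" using ndl ev by (simp add: ndl_graph_def Let_def)
  moreover have "Max (set es) \<in> set es" using es(2) n by (intro Max_in) auto
  ultimately have "real d \<in># mset es" by simp
  \<comment> \<open>Only one copy of \<open>d\<close> is removed; further copies stay in
    \<open>R\<close> and are bounded by \<open>lam\<close> as well.\<close>
  then obtain R where R: "mset es = add_mset (real d) R" by (metis multi_member_split)
  show thesis
  proof (rule that[OF f M])
    fix m
    have "(\<Sum>i<n. (adj_mat V E ^\<^sub>m m) $$ (i,i)) = (\<Sum>e\<leftarrow>es. e ^ m)"
      by (rule trace_pow_eigenvalues[OF carr es(1)])
    also have "\<dots> = (\<Sum>e\<in>#mset es. e ^ m)" by (metis mset_map sum_mset_sum_list)
    finally show "(\<Sum>i<n. (adj_mat V E ^\<^sub>m m) $$ (i,i)) = real d ^ m + (\<Sum>e\<in>#R. e ^ m)"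
      by (simp add: R)
  next
    fix e assume "e \<in># R"
    thus "\<bar>e\<bar> \<le> lam"
      using ndl ev R \<open>Max (set es) = real d\<close> by (auto simp: ndl_graph_def Let_def)
  next
    have "size (mset es) = n" using es(2) by simp
    thus "Suc (size R) = n" unfolding R by simp
  qed
qed

text \<open>With two vertices there is a second eigenvalue, whose absolute value is at most
  \<open>lam\<close>.\<close>

lemma ndl_graph_lam_nonneg:
  assumes "ndl_graph V E n d lam" "2 \<le> n"
  shows "0 \<le> lam"
proof -
  obtain R where R: "\<And>e. e \<in># R \<Longrightarrow> \<bar>e\<bar> \<le> lam" "Suc (size R) = n"
    using ndl_graph_adj_eigenvalues[OF assms(1)] assms(2) by (metis not_gr_zero not_numeral_le_zero)
  then obtain e where "e \<in># R" using assms(2) by (cases R) auto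
  thus ?thesis using R(1) abs_ge_zero order_trans by blast
qed

text \<open>Carries the bound for index matrices over to functions on vertices: the rows of A^m sum
  to d^m by regularity, and the trace bound comes from the spectrum.\<close>

lemma ndl_graph_norm_bound:
  fixes x :: "'a \<Rightarrow> real"
  assumes ndl: "ndl_graph V E n d lam" and n: "0 < n" and x: "(\<Sum>v\<in>V. x v) = 0"
  shows "(\<Sum>u\<in>V. (\<Sum>v\<in>V. of_bool (E u v) * x v)\<^sup>2) \<le> lam\<^sup>2 * (\<Sum>v\<in>V. (x v)\<^sup>2)"
proof -
  obtain f R where f: "bij_betw f {..<n} V"
    and M: "adj_mat V E = mat n n (\<lambda>(i, j). of_bool (E (f i) (f j)))"
    and tr: "\<And>m. (\<Sum>i<n. (adj_mat V E ^\<^sub>m m) $$ (i,i)) = real d ^ m + (\<Sum>e\<in>#R. e ^ m)"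
    and R: "\<And>e. e \<in># R \<Longrightarrow> \<bar>e\<bar> \<le> lam" "Suc (size R) = n"
    by (rule ndl_graph_adj_eigenvalues[OF ndl n], rule that)
  define a where "a m i j = (adj_mat V E ^\<^sub>m m) $$ (i,j)" for m i j
  have fin: "finite V" and E_sym: "E u v \<longleftrightarrow> E v u" for u v
    using ndl by (auto simp: ndl_graph_def is_graph_def)
  have carr: "adj_mat V E \<in> carrier_mat n n" by (simp add: M)
  have a1: "a 1 i j = of_bool (E (f i) (f j))" if "i < n" "j < n" for i j
    using that left_mult_one_mat[OF carr] by (simp add: a_def M)
  have add: "a (m + m') i j = (\<Sum>l<n. a m i l * a m' l j)" if "i < n" "j < n" for m m' i j
    using that carrier_matD[OF carr]
    unfolding a_def pow_mat_add[OF carr] by (simp add: scalar_prod_def atLeast0LessThan)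
  have one: "a 0 i j = (if i = j then 1 else 0)" if "i < n" "j < n" for i j
    using that carr by (simp add: a_def)
  have sym: "a m i j = a m j i" if "i < n" "j < n" for m i j
    using that
  proof (induction m arbitrary: i j)
    case (Suc m)
    have "a (m + 1) i j = (\<Sum>l<n. a m i l * a 1 l j)" using Suc.prems by (rule add)
    also have "\<dots> = (\<Sum>l<n. a 1 j l * a m l i)"
    proof (intro sum.cong refl)
      fix l assume "l \<in> {..<n}"
      hence "a 1 l j = a 1 j l" "a m i l = a m l i"
        using Suc.prems E_sym by (simp_all only: a1 lessThan_iff Suc.IH)
      thus "a m i l * a 1 l j = a 1 j l * a m l i" by simp
    qed
    also have "\<dots> = a (1 + m) j i" using Suc.prems(2,1) by (rule add[symmetric])
    finally show ?case by simp
  qed (simp add: one)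
  have row1: "(\<Sum>j<n. a 1 i j) = real d" if "i < n" for i
  proof -
    have fi: "f i \<in> V" using f that by (auto simp: bij_betw_def)
    have "(\<Sum>j<n. a 1 i j) = (\<Sum>j<n. of_bool (E (f i) (f j)))"
      using that by (intro sum.cong refl a1) auto
    also have "\<dots> = (\<Sum>v\<in>V. of_bool (E (f i) v))" by (rule sum.reindex_bij_betw[OF f])
    also have "\<dots> = real (card {v \<in> V. E (f i) v})" using fin by (simp add: Int_def)
    finally show ?thesis using ndl fi by (simp add: ndl_graph_def degree_def)
  qed
  have row: "(\<Sum>j<n. a m i j) = real d ^ m" if "i < n" for m i
  proof (induction m)
    case (Suc m)
    have "(\<Sum>j<n. a (m + 1) i j) = (\<Sum>j<n. \<Sum>l<n. a m i l * a 1 l j)"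
      using that by (intro sum.cong refl add) auto
    also have "\<dots> = (\<Sum>l<n. \<Sum>j<n. a m i l * a 1 l j)" by (rule sum.swap)
    also have "\<dots> = (\<Sum>l<n. a m i l * real d)"
      unfolding sum_distrib_left[symmetric] by (intro sum.cong refl) (simp add: row1[simplified])
    also have "\<dots> = real d ^ Suc m" unfolding sum_distrib_right[symmetric] Suc by simp
    finally show ?case by simp
  qed (use that in \<open>simp add: one\<close>)
  have tr': "(\<Sum>i<n. a (2 * m) i i) \<le> real d ^ (2 * m) + n * lam ^ (2 * m)" for m
  proof -
    \<comment> \<open>The exponent is even, so bounds on absolute values suffice.\<close>
    have "(\<Sum>e\<in>#R. e ^ (2 * m)) \<le> (\<Sum>e\<in>#R. lam ^ (2 * m))"
    proof (rule sum_mset_mono)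
      fix e assume "e \<in># R"
      hence "\<bar>e\<bar> ^ (2 * m) \<le> lam ^ (2 * m)" using R(1) by (intro power_mono) auto
      thus "e ^ (2 * m) \<le> lam ^ (2 * m)" by (simp add: power_mult)
    qed
    also have "\<dots> = size R * lam ^ (2 * m)" by simp
    also have "\<dots> \<le> n * lam ^ (2 * m)" using R(2) by (intro mult_right_mono) (auto simp: power_mult)
    finally show ?thesis using tr[of "2 * m"] by (simp add: a_def)
  qed
  have "(\<Sum>j<n. x (f j)) = 0" using sum.reindex_bij_betw[OF f, of x] x by simp
  from trace_bound_imp_norm_bound[of n a "real d" lam "\<lambda>j. x (f j)", OF add one sym row tr' this]
  have "(\<Sum>i<n. (\<Sum>j<n. of_bool (E (f i) (f j)) * x (f j))\<^sup>2) \<le> lam\<^sup>2 * (\<Sum>j<n. (x (f j))\<^sup>2)"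
    by (simp add: a1[simplified])
  moreover have "(\<Sum>j<n. of_bool (E u (f j)) * x (f j)) = (\<Sum>v\<in>V. of_bool (E u v) * x v)" for u
    by (rule sum.reindex_bij_betw[OF f])
  moreover have "(\<Sum>j<n. (x (f j))\<^sup>2) = (\<Sum>v\<in>V. (x v)\<^sup>2)" by (rule sum.reindex_bij_betw[OF f])
  moreover have "(\<Sum>i<n. (\<Sum>v\<in>V. of_bool (E (f i) v) * x v)\<^sup>2) = (\<Sum>u\<in>V. (\<Sum>v\<in>V. of_bool (E u v) * x v)\<^sup>2)"
    by (rule sum.reindex_bij_betw[OF f])
  ultimately show ?thesis by simp
qed

text \<open>The norm bound is applied to the indicator of \<open>A\<close> minus its mean
  \<open>c\<close>. The deviation is the sum over \<open>B\<close> of the image \<open>y\<close> of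
  this vector, which Cauchy-Schwarz estimates.\<close>

lemma expander_mixing:
  assumes ndl: "ndl_graph V E n d lam" and n: "0 < n" and lam: "0 \<le> lam"
    and A: "A \<subseteq> V" and B: "B \<subseteq> V"
  shows "\<bar>(\<Sum>b\<in>B. real (card {a \<in> A. E b a})) - real d * real (card A) * real (card B) / real n\<bar>
    \<le> lam * sqrt (real (card A) * real (card B))"
proof -
  have fin: "finite V" and V: "card V = n" using ndl by (auto simp: ndl_graph_def is_graph_def)
  have finA: "finite A" and finB: "finite B" using A B fin by (auto intro: finite_subset)
  define c where "c = real (card A) / real n"
  define x where "x v = of_bool (v \<in> A) - c" for v
  define y where "y u = (\<Sum>v\<in>V. of_bool (E u v) * x v)" for u
  have cardA: "(\<Sum>v\<in>V. of_bool (v \<in> A)) = real (card A)"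
    using fin A by (simp add: Int_absorb1 Int_def[symmetric])
  have "(\<Sum>v\<in>V. x v) = 0" using n by (simp add: x_def sum_subtractf cardA V c_def)
  hence bound: "(\<Sum>u\<in>V. (y u)\<^sup>2) \<le> lam\<^sup>2 * (\<Sum>v\<in>V. (x v)\<^sup>2)"
    unfolding y_def by (rule ndl_graph_norm_bound[OF ndl n])
  have "(of_bool (v \<in> A))\<^sup>2 = (of_bool (v \<in> A) :: real)" for v by simp
  \<comment> \<open>The squared norm of \<open>x\<close> is |A| - |A|^2 / n, by idempotence of the
    indicator.\<close>
  hence "(\<Sum>v\<in>V. (x v)\<^sup>2) = (\<Sum>v\<in>V. of_bool (v \<in> A)) - 2 * c * (\<Sum>v\<in>V. of_bool (v \<in> A)) + n * c\<^sup>2"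
    unfolding x_def by (simp add: power2_diff sum.distrib sum_subtractf sum_distrib_left V ac_simps)
  also have "\<dots> = card A - card A * c"
    unfolding cardA using n by (simp add: c_def power2_eq_square field_simps)
  also have "\<dots> \<le> card A" by (simp add: c_def)
  finally have xA: "(\<Sum>v\<in>V. (x v)\<^sup>2) \<le> card A" .
  have yB: "y b = card {a \<in> A. E b a} - d * c" if "b \<in> B" for b
  proof -
    have "y b = (\<Sum>v\<in>V. of_bool (v \<in> A \<and> E b v)) - (\<Sum>v\<in>V. of_bool (E b v)) * c"
      unfolding y_def x_def sum_distrib_right sum_subtractf[symmetric]
      by (intro sum.cong) (auto simp: algebra_simps)
    also have "(\<Sum>v\<in>V. of_bool (v \<in> A \<and> E b v)) = real (card {a \<in> A. E b a})"
      using fin A by (simp add: Int_absorb1 subset_iff Collect_mono)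
    also have "(\<Sum>v\<in>V. of_bool (E b v)) = real (card {v \<in> V. E b v})"
      using fin by (simp add: Int_def)
    also have "card {v \<in> V. E b v} = d" using ndl that B by (auto simp: ndl_graph_def degree_def)
    finally show ?thesis .
  qed
  define D where "D = (\<Sum>b\<in>B. real (card {a \<in> A. E b a})) - real d * real (card A) * real (card B) / real n"
  have "D = (\<Sum>b\<in>B. 1 * y b)"
    by (simp add: D_def yB sum_subtractf c_def)
  hence "D\<^sup>2 \<le> (\<Sum>b\<in>B. 1\<^sup>2) * (\<Sum>b\<in>B. (y b)\<^sup>2)"
    using Cauchy_Schwarz_ineq_sum[of "\<lambda>_. 1" y B] by simp
  also have "\<dots> = card B * (\<Sum>b\<in>B. (y b)\<^sup>2)" by simp
  also have "\<dots> \<le> card B * (lam\<^sup>2 * card A)"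
  proof (rule mult_left_mono)
    have "(\<Sum>b\<in>B. (y b)\<^sup>2) \<le> (\<Sum>u\<in>V. (y u)\<^sup>2)" using fin B by (intro sum_mono2) auto
    also note bound
    also have "lam\<^sup>2 * (\<Sum>v\<in>V. (x v)\<^sup>2) \<le> lam\<^sup>2 * card A" using xA by (rule mult_left_mono) simp
    finally show "(\<Sum>b\<in>B. (y b)\<^sup>2) \<le> lam\<^sup>2 * card A" .
  qed simp
  also have "\<dots> = (lam * sqrt (real (card A) * real (card B)))\<^sup>2"
    unfolding power_mult_distrib by (simp only: real_sqrt_pow2 mult_nonneg_nonneg of_nat_0_le_iff ac_simps)
  finally have "\<bar>D\<bar> \<le> \<bar>lam * sqrt (real (card A) * real (card B))\<bar>"
    by (simp only: abs_le_square_iff)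
  also have "\<dots> = lam * sqrt (real (card A) * real (card B))"
    using lam by (intro abs_of_nonneg mult_nonneg_nonneg) auto
  finally show ?thesis unfolding D_def .
qed

section \<open>Basic facts on Ramsey numbers\<close>

lemma ramsey_prop_mono:
  assumes "ramsey_prop s k N" "N \<le> N'"
  shows "ramsey_prop s k N'"
  unfolding ramsey_prop_def
proof (intro allI impI)
  fix E :: "nat \<Rightarrow> nat \<Rightarrow> bool" assume "\<forall>u v. E u v \<longrightarrow> E v u"
  with assms(1) have *: "(\<exists>S \<subseteq> {..<N}. card S = s \<and> (\<forall>x\<in>S. \<forall>y\<in>S. x \<noteq> y \<longrightarrow> E x y)) \<or>
      (\<exists>S \<subseteq> {..<N}. card S = k \<and> (\<forall>x\<in>S. \<forall>y\<in>S. x \<noteq> y \<longrightarrow> \<not> E x y))"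
    unfolding ramsey_prop_def by (elim allE[of _ E] impE)
  have mono: "\<exists>S \<subseteq> {..<N'}. P S" if ex: "\<exists>S \<subseteq> {..<N}. P S" for P
  proof -
    obtain S where "S \<subseteq> {..<N}" "P S" using ex by blast
    moreover from this(1) have "S \<subseteq> {..<N'}" using assms(2) by (meson lessThan_subset_iff subset_trans)
    ultimately show ?thesis by blast
  qed
  from * show "(\<exists>S \<subseteq> {..<N'}. card S = s \<and> (\<forall>x\<in>S. \<forall>y\<in>S. x \<noteq> y \<longrightarrow> E x y)) \<or>
      (\<exists>S \<subseteq> {..<N'}. card S = k \<and> (\<forall>x\<in>S. \<forall>y\<in>S. x \<noteq> y \<longrightarrow> \<not> E x y))"
    by (rule disj_forward) (erule mono)+
qed

text \<open>Finite Ramsey theorem, which makes the \<open>LEAST\<close> in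
  \<open>ramsey_number\<close> meaningful.\<close>

lemma ramsey_prop_exists: "\<exists>N. ramsey_prop s k N"
proof -
  obtain r where r: "\<And>(V::nat set) E. finite V \<Longrightarrow> card V \<ge> r \<Longrightarrow>
      \<exists>R \<subseteq> V. card R = s \<and> clique R E \<or> card R = k \<and> indep R E"
    using ramsey2[of s k] by metis
  have "ramsey_prop s k r"
    unfolding ramsey_prop_def
  proof (intro allI impI)
    fix E :: "nat \<Rightarrow> nat \<Rightarrow> bool" assume sym: "\<forall>u v. E u v \<longrightarrow> E v u"
    have E: "{x, y} \<in> {{u, v} |u v. E u v} \<longleftrightarrow> E x y" for x y
      using sym by (auto simp: doubleton_eq_iff)
    show "(\<exists>S \<subseteq> {..<r}. card S = s \<and> (\<forall>x\<in>S. \<forall>y\<in>S. x \<noteq> y \<longrightarrow> E x y)) \<or>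
        (\<exists>S \<subseteq> {..<r}. card S = k \<and> (\<forall>x\<in>S. \<forall>y\<in>S. x \<noteq> y \<longrightarrow> \<not> E x y))"
      using r[of "{..<r}" "{{u, v} |u v. E u v}"] unfolding clique_def indep_def E by auto
  qed
  thus ?thesis ..
qed

lemma less_ramsey_number:
  assumes "\<not> ramsey_prop s k N"
  shows "N < ramsey_number s k"
proof (rule ccontr)
  assume "\<not> N < ramsey_number s k"
  moreover have "ramsey_prop s k (ramsey_number s k)"
    unfolding ramsey_number_def using ramsey_prop_exists by (rule LeastI_ex)
  ultimately show False using assms ramsey_prop_mono by simp
qed

text \<open>The edgeless graph on \<open>k - 1\<close> vertices has neither set. This trivial bound
  settles the case \<eta> > 1 of the theorem.\<close>

lemma le_ramsey_number:
  assumes "2 \<le> s" "0 < k"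
  shows "k \<le> ramsey_number s k"
proof -
  have "\<not> ramsey_prop s k (k - 1)"
  proof
    assume "ramsey_prop s k (k - 1)"
    hence "(\<exists>S \<subseteq> {..<k - 1}. card S = s \<and> (\<forall>x\<in>S. \<forall>y\<in>S. x \<noteq> y \<longrightarrow> False)) \<or>
        (\<exists>S \<subseteq> {..<k - 1}. card S = k \<and> (\<forall>x\<in>S. \<forall>y\<in>S. x \<noteq> y \<longrightarrow> \<not> False))"
      unfolding ramsey_prop_def by (elim allE[of _ "\<lambda>_ _. False"] impE) simp
    thus False
    proof (elim disjE exE conjE)
      fix S assume S: "card S = s" "\<forall>x\<in>S. \<forall>y\<in>S. x \<noteq> y \<longrightarrow> False"
      have "finite S" using S(1) assms(1) by (intro card_ge_0_finite) simp
      moreover have "\<forall>x\<in>S. \<forall>y\<in>S. x = y" using S(2) by simp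
      ultimately have "card S \<le> Suc 0" by (simp add: card_le_Suc0_iff_eq)
      thus False using S(1) assms(1) by simp
    next
      fix S assume "S \<subseteq> {..<k - 1}" "card S = k"
      hence "k \<le> card {..<k - 1}" using card_mono[OF finite_lessThan] by metis
      thus False using assms(2) by simp
    qed
  qed
  from less_ramsey_number[OF this] show ?thesis by simp
qed

section \<open>Independent sets of the random graph and their expected number\<close>

text \<open>Number of the tuples \<open>((a\<^sub>1, b\<^sub>1), \<dots>, (a\<^sub>k, b\<^sub>k))\<close> over \<open>E\<close> with all \<open>a\<^sub>i\<close> in \<open>A\<close> and no
  \<open>G\<close>-edge \<open>a\<^sub>i b\<^sub>j\<close> for \<open>i < j\<close>; the recursion chooses the last pair first.\<close>
fun indep_tuples :: "('a \<times> 'a) set \<Rightarrow> ('a \<Rightarrow> 'a \<Rightarrow> bool) \<Rightarrow> nat \<Rightarrow> 'a set \<Rightarrow> nat" where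
  "indep_tuples E G 0 A = 1"
| "indep_tuples E G (Suc k) A =
     (\<Sum>e\<in>{e \<in> E. fst e \<in> A}. indep_tuples E G k {a \<in> A. \<not> G (snd e) a})"

text \<open>For \<open>A = V\<close> and pairs \<open>f i\<close> from \<open>E\<close> these are
  the independent \<open>k\<close>-sets of the random graph given by \<open>f\<close>. A general
  \<open>A\<close> lets the count follow the recursion of \<open>indep_tuples\<close>.\<close>

definition indep_sets ::
    "('a \<Rightarrow> 'a \<Rightarrow> bool) \<Rightarrow> nat \<Rightarrow> nat \<Rightarrow> 'a set \<Rightarrow> (nat \<Rightarrow> 'a \<times> 'a) \<Rightarrow> nat set set" where
  "indep_sets G M k A f = {I. I \<subseteq> {..<M} \<and> card I = k \<and> (\<forall>i\<in>I. fst (f i) \<in> A) \<and>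
     (\<forall>i\<in>I. \<forall>j\<in>I. i < j \<longrightarrow> \<not> G (snd (f j)) (fst (f i)))}"

lemma finite_indep_sets: "finite (indep_sets G M k A f)"
  by (rule finite_subset[of _ "Pow {..<M}"]) (auto simp: indep_sets_def)

lemma indep_sets_0: "indep_sets G M 0 A f = {{}}"
  unfolding indep_sets_def by (auto simp: card_eq_0_iff dest: finite_subset)

lemma indep_sets_fun_upd: "indep_sets G M k A (f(M := e)) = indep_sets G M k A f"
proof -
  have upd: "(f(M := e)) i = f i" if "I \<subseteq> {..<M}" "i \<in> I" for I i using that by auto
  show ?thesis
    unfolding indep_sets_def
    by (intro Collect_cong conj_cong refl ball_cong imp_cong) (simp_all only: upd)
qed

text \<open>A set avoiding \<open>M\<close> only sees \<open>f\<close>. A set containing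
  \<open>M\<close> needs \<open>fst e\<close> in \<open>A\<close>, and the first endpoints of its
  other members must avoid the \<open>G\<close>-neighbours of \<open>snd e\<close>, because
  \<open>M\<close> is the largest index.\<close>

lemma card_indep_sets_Suc:
  "card (indep_sets G (Suc M) (Suc k) A (f(M := e))) \<le> card (indep_sets G M (Suc k) A f)
     + (if fst e \<in> A then card (indep_sets G M k {a \<in> A. \<not> G (snd e) a} f) else 0)"
proof -
  let ?A' = "{a \<in> A. \<not> G (snd e) a}" and ?f = "f(M := e)"
  have sub: "indep_sets G (Suc M) (Suc k) A ?f
      \<subseteq> indep_sets G M (Suc k) A ?f \<union> (if fst e \<in> A then insert M ` indep_sets G M k ?A' ?f else {})"
  proof
    fix I assume "I \<in> indep_sets G (Suc M) (Suc k) A ?f"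
    hence I: "I \<subseteq> {..<Suc M}" "card I = Suc k" "\<And>i. i \<in> I \<Longrightarrow> fst (?f i) \<in> A"
      "\<And>i j. i \<in> I \<Longrightarrow> j \<in> I \<Longrightarrow> i < j \<Longrightarrow> \<not> G (snd (?f j)) (fst (?f i))"
      unfolding indep_sets_def by blast+
    show "I \<in> indep_sets G M (Suc k) A ?f \<union> (if fst e \<in> A then insert M ` indep_sets G M k ?A' ?f else {})"
    proof (cases "M \<in> I")
      case False
      hence "I \<subseteq> {..<M}" using I(1) by (auto simp: less_Suc_eq)
      hence "I \<in> indep_sets G M (Suc k) A ?f" unfolding indep_sets_def using I by blast
      thus ?thesis by blast
    next
      case True
      have lt: "i < M" if "i \<in> I - {M}" for i using that I(1) by (auto simp: less_Suc_eq)
      have eA: "fst e \<in> A" using I(3)[OF True] by simp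
      have a': "fst (?f i) \<in> A \<and> \<not> G (snd e) (fst (?f i))" if "i \<in> I - {M}" for i
        using I(3)[of i] I(4)[of i M] True lt[OF that] that by simp
      have mem: "I - {M} \<in> indep_sets G M k ?A' ?f"
        unfolding indep_sets_def
      proof (intro CollectI conjI ballI impI)
        show "I - {M} \<subseteq> {..<M}" using lt by blast
        show "card (I - {M}) = k" using True I(2) by (simp add: card_Diff_singleton)
        fix i j assume "i \<in> I - {M}" "j \<in> I - {M}" "i < j"
        thus "\<not> G (snd (?f j)) (fst (?f i))" by (intro I(4)) auto
      qed (simp_all only: a' not_False_eq_True)
      have "I \<in> insert M ` indep_sets G M k ?A' ?f"
        using True by (intro image_eqI[OF _ mem]) blast
      thus ?thesis using eA by simp
    qed
  qed
  have "card (indep_sets G (Suc M) (Suc k) A ?f)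
      \<le> card (indep_sets G M (Suc k) A ?f \<union> (if fst e \<in> A then insert M ` indep_sets G M k ?A' ?f else {}))"
    by (rule card_mono[OF _ sub]) (simp add: finite_indep_sets)
  also have "\<dots> \<le> card (indep_sets G M (Suc k) A ?f)
      + card (if fst e \<in> A then insert M ` indep_sets G M k ?A' ?f else {})"
    by (rule card_Un_le)
  also have "\<dots> \<le> card (indep_sets G M (Suc k) A ?f)
      + (if fst e \<in> A then card (indep_sets G M k ?A' ?f) else 0)"
    by (simp add: card_image_le finite_indep_sets)
  finally show ?thesis unfolding indep_sets_fun_upd .
qed

text \<open>This is the expectation bound with denominators cleared. Splitting off the pair with the
  largest index matches the recursion of \<open>indep_tuples\<close>, and the binomials combine by
  Pascal's rule.\<close>

lemma sum_card_indep_sets_le: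
  assumes E: "finite E"
  shows "(\<Sum>f\<in>{..<M} \<rightarrow>\<^sub>E E. card (indep_sets G M k A f)) * card E ^ k
    \<le> (M choose k) * card E ^ M * indep_tuples E G k A"
proof (induction M arbitrary: k A)
  case 0
  show ?case
  proof (cases k)
    case (Suc k')
    hence "indep_sets G 0 k A f = {}" for f by (auto simp: indep_sets_def)
    thus ?thesis by simp
  qed (simp add: indep_sets_0)
next
  case (Suc M)
  show ?case
  proof (cases k)
    case 0
    thus ?thesis by (simp add: indep_sets_0 card_PiE E)
  next
    case k: (Suc k')
    let ?P = "{..<M} \<rightarrow>\<^sub>E E" and ?A' = "\<lambda>e. {a \<in> A. \<not> G (snd e) a}"
    define c where "c k A = (\<Sum>f\<in>?P. card (indep_sets G M k A f))" for k A
    \<comment> \<open>A choice of \<open>Suc M\<close> pairs is a choice of \<open>M\<close> pairs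
      together with the value \<open>e\<close> at index \<open>M\<close>.\<close>
    have "{..<Suc M} \<rightarrow>\<^sub>E E = (\<lambda>(e, f). f(M := e)) ` (E \<times> ?P)"
      by (simp add: lessThan_Suc PiE_insert_eq)
    moreover have "inj_on (\<lambda>(e, f). f(M := e)) (E \<times> ?P)"
      using inj_combinator[of M "{..<M}" "\<lambda>_. E"] by simp
    ultimately have "(\<Sum>f\<in>{..<Suc M} \<rightarrow>\<^sub>E E. card (indep_sets G (Suc M) k A f))
        = (\<Sum>e\<in>E. \<Sum>f\<in>?P. card (indep_sets G (Suc M) k A (f(M := e))))"
      by (simp add: sum.reindex sum.cartesian_product case_prod_unfold)
    also have "\<dots> \<le> (\<Sum>e\<in>E. \<Sum>f\<in>?P. card (indep_sets G M (Suc k') A f)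
        + (if fst e \<in> A then card (indep_sets G M k' (?A' e) f) else 0))"
      unfolding k by (intro sum_mono card_indep_sets_Suc)
    also have "\<dots> = (\<Sum>e\<in>E. c k A + (if fst e \<in> A then c k' (?A' e) else 0))"
      by (intro sum.cong refl) (simp add: sum.distrib c_def k)
    also have "\<dots> = card E * c k A + (\<Sum>e\<in>{e \<in> E. fst e \<in> A}. c k' (?A' e))"
      using E by (simp add: sum.distrib sum.inter_filter)
    finally have "(\<Sum>f\<in>{..<Suc M} \<rightarrow>\<^sub>E E. card (indep_sets G (Suc M) k A f)) * card E ^ k
        \<le> (card E * c k A + (\<Sum>e\<in>{e \<in> E. fst e \<in> A}. c k' (?A' e))) * card E ^ k"
      by (rule mult_right_mono) simp
    also have "\<dots> = card E * (c k A * card E ^ k)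
        + card E * (\<Sum>e\<in>{e \<in> E. fst e \<in> A}. c k' (?A' e) * card E ^ k')"
      by (simp add: k distrib_left distrib_right sum_distrib_left sum_distrib_right ac_simps)
    also have "\<dots> \<le> card E * ((M choose k) * card E ^ M * indep_tuples E G k A)
        + card E * (\<Sum>e\<in>{e \<in> E. fst e \<in> A}. (M choose k') * card E ^ M * indep_tuples E G k' (?A' e))"
      unfolding c_def by (intro add_mono mult_left_mono sum_mono Suc.IH) simp_all
    also have "\<dots> = (Suc M choose k) * card E ^ Suc M * indep_tuples E G k A"
      by (simp add: k sum_distrib_left[symmetric] algebra_simps)
    finally show ?thesis .
  qed
qed

text \<open>First moment method: if every \<open>f\<close> had an independent set, the expected
  number would be at least 1.\<close>

lemma exists_indep_sets_empty:
  assumes E: "finite E" "E \<noteq> {}" and few: "(M choose k) * indep_tuples E G k A < card E ^ k"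
  shows "\<exists>f. f \<in> {..<M} \<rightarrow>\<^sub>E E \<and> indep_sets G M k A f = {}"
proof (rule ccontr)
  assume none: "\<not> ?thesis"
  have "indep_sets G M k A f \<noteq> {}" if "f \<in> {..<M} \<rightarrow>\<^sub>E E" for f
    using none that by blast
  hence "1 \<le> card (indep_sets G M k A f)" if "f \<in> {..<M} \<rightarrow>\<^sub>E E" for f
    using that by (simp add: Suc_le_eq card_gt_0_iff finite_indep_sets)
  hence "(\<Sum>f\<in>{..<M} \<rightarrow>\<^sub>E E. 1) \<le> (\<Sum>f\<in>{..<M} \<rightarrow>\<^sub>E E. card (indep_sets G M k A f))"
    by (intro sum_mono)
  hence "card E ^ M \<le> (\<Sum>f\<in>{..<M} \<rightarrow>\<^sub>E E. card (indep_sets G M k A f))" by (simp add: card_PiE)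
  hence "card E ^ M * card E ^ k \<le> (\<Sum>f\<in>{..<M} \<rightarrow>\<^sub>E E. card (indep_sets G M k A f)) * card E ^ k"
    by (rule mult_right_mono) simp
  also have "\<dots> \<le> (M choose k) * card E ^ M * indep_tuples E G k A"
    by (rule sum_card_indep_sets_le[OF E(1)])
  finally have "card E ^ M * card E ^ k \<le> card E ^ M * ((M choose k) * indep_tuples E G k A)"
    by (simp add: ac_simps)
  moreover have "0 < card E ^ M" using E by (simp add: card_gt_0_iff)
  ultimately show False using few by simp
qed

text \<open>The pairs indexed by an \<open>s\<close>-clique, in increasing order, form a forbidden
  copy of H_s.\<close>

lemma not_ramsey_prop_of_indep_sets_empty:
  assumes free: "Hs_free s V F G" and symG: "\<And>u v. G u v \<Longrightarrow> G v u"
    and E: "\<And>a b. (a, b) \<in> E \<Longrightarrow> a \<in> V \<and> b \<in> V \<and> F a b"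
    and f: "f \<in> {..<M} \<rightarrow>\<^sub>E E" and no_indep: "indep_sets G M k V f = {}"
  shows "\<not> ramsey_prop s k M"
proof
  define H where "H i j \<longleftrightarrow> i \<noteq> j \<and> G (snd (f (max i j))) (fst (f (min i j)))" for i j
  have fE: "fst (f i) \<in> V \<and> snd (f i) \<in> V \<and> F (fst (f i)) (snd (f i))" if "i < M" for i
    using E[of "fst (f i)" "snd (f i)"] f that by auto
  assume "ramsey_prop s k M"
  moreover have "\<forall>u v. H u v \<longrightarrow> H v u" by (auto simp: H_def max.commute min.commute)
  ultimately have "(\<exists>S \<subseteq> {..<M}. card S = s \<and> (\<forall>x\<in>S. \<forall>y\<in>S. x \<noteq> y \<longrightarrow> H x y)) \<or>
      (\<exists>S \<subseteq> {..<M}. card S = k \<and> (\<forall>x\<in>S. \<forall>y\<in>S. x \<noteq> y \<longrightarrow> \<not> H x y))"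
    unfolding ramsey_prop_def by (elim allE[of _ H] impE)
  thus False
  proof (elim disjE exE conjE)
    fix S assume 1: "S \<subseteq> {..<M}" "card S = s" "\<forall>x\<in>S. \<forall>y\<in>S. x \<noteq> y \<longrightarrow> H x y"
    \<comment> \<open>\<open>l\<close> sorts the clique; the shift \<open>i - 1\<close> below arises
      because H_s counts from 1 and lists from 0.\<close>
    define l where "l = sorted_list_of_set S"
    have fin: "finite S" using 1(1) finite_subset by blast
    have l: "length l = s" "set l = S" "sorted_wrt (<) l"
      using fin 1(2) by (simp_all add: l_def)
    have mem: "l ! (i - 1) \<in> S" if "i \<in> {1..s}" for i using that l by (auto intro!: nth_mem)
    have lt: "l ! (i - 1) < l ! (j - 1)" if "i \<in> {1..s}" "j \<in> {1..s}" "i < j" for i j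
      using that l by (intro sorted_wrt_nth_less[OF l(3)]) auto
    have "G (fst (f (l ! (i - 1)))) (snd (f (l ! (j - 1))))" if ij: "i \<in> {1..s}" "j \<in> {1..s}" "i < j" for i j
    proof -
      have "H (l ! (i - 1)) (l ! (j - 1))" using 1(3) mem ij lt[OF ij] by simp
      thus ?thesis using lt[OF ij] by (auto simp: H_def max_def min_def intro: symG)
    qed
    moreover have "l ! (i - 1) < M" if "i \<in> {1..s}" for i using mem[OF that] 1(1) by auto
    ultimately have "\<exists>a b. (\<forall>i\<in>{1..s}. a i \<in> V \<and> b i \<in> V) \<and> (\<forall>i\<in>{1..s}. F (a i) (b i)) \<and>
        (\<forall>i\<in>{1..s}. \<forall>j\<in>{1..s}. i < j \<longrightarrow> G (a i) (b j))"
      using fE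
      by (intro exI[of _ "\<lambda>i. fst (f (l ! (i - 1)))"] exI[of _ "\<lambda>i. snd (f (l ! (i - 1)))"] conjI ballI impI) simp_all
    thus False using free unfolding Hs_free_def by (rule notE[rotated])
  next
    fix S assume 2: "S \<subseteq> {..<M}" "card S = k" "\<forall>x\<in>S. \<forall>y\<in>S. x \<noteq> y \<longrightarrow> \<not> H x y"
    have "S \<in> indep_sets G M k V f"
      unfolding indep_sets_def
    proof (intro CollectI conjI ballI impI)
      fix i j assume "i \<in> S" "j \<in> S" "i < j"
      thus "\<not> G (snd (f j)) (fst (f i))" using bspec[OF bspec[OF 2(3)], of i j] by (simp add: H_def max_def min_def)
    qed (use 2 fE in auto)
    thus False using no_indep by simp
  qed
qed

section \<open>Few tuples are independent\<close>

text \<open>A choice either removes a \<open>\<delta>\<close>-fraction of \<open>A\<close>, which decreases the exponent by one,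
  or is one of at most \<open>q * card E\<close> exceptional choices.\<close>
lemma indep_tuples_le:
  fixes q \<delta> :: real
  assumes V: "finite V" and E: "finite E" and q: "0 < q" "q \<le> 1" and \<delta>: "0 < \<delta>"
    and few: "\<And>A. A \<subseteq> V \<Longrightarrow>
      real (card {e \<in> E. fst e \<in> A \<and> real (card {a \<in> A. G (snd e) a}) < \<delta> * card A}) \<le> q * card E"
    and A: "A \<subseteq> V"
  shows "real (indep_tuples E G k A)
    \<le> (2 * q * card E) ^ k * (1 / q) powr (if A = {} then 0 else 1 + ln (card A) / \<delta>)"
  using A
proof (induction k arbitrary: A)
  case 0
  have "0 \<le> (if A = {} then 0 else 1 + ln (card A) / \<delta>)"
    using \<delta> finite_subset[OF 0 V] by (auto simp: card_gt_0_iff Suc_le_eq intro!: add_nonneg_nonneg divide_nonneg_nonneg)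
  hence "1 \<le> (1 / q) powr (if A = {} then 0 else 1 + ln (card A) / \<delta>)"
    using q by (intro ge_one_powr_ge_zero) auto
  thus ?case by simp
next
  case (Suc k)
  show ?case
  proof (cases "A = {}")
    case True
    thus ?thesis using q by simp
  next
    case False
    have finA: "finite A" using Suc.prems V by (rule finite_subset)
    hence cA: "1 \<le> real (card A)" using False by (simp add: Suc_le_eq card_gt_0_iff)
    \<comment> \<open>The budget of choices that shrink \<open>A\<close>. The summand 1 pays for the
      choice that empties \<open>A\<close>, where the logarithm no longer measures progress.\<close>
    define h where "h A = (if A = {} then 0 else 1 + ln (real (card A)) / \<delta>)" for A :: "'a set"
    define N where "N = real (card E)"
    define L where "L = (2 * q * N) ^ k * (1 / q) powr h A"
    define A' where "A' e = {a \<in> A. \<not> G (snd e) a}" for e :: "'a \<times> 'a"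
    define X where "X = {e \<in> E. fst e \<in> A}"
    define bad where "bad = {e \<in> X. real (card {a \<in> A. G (snd e) a}) < \<delta> * card A}"
    have N: "0 \<le> N" by (simp add: N_def)
    have L: "0 \<le> L" using q N by (simp add: L_def)
    have sub: "A' e \<subseteq> A" for e by (auto simp: A'_def)
    have IH: "real (indep_tuples E G k (A' e)) \<le> (2 * q * N) ^ k * (1 / q) powr h (A' e)" for e
      using Suc.IH[of "A' e"] sub[of e] Suc.prems by (auto simp: N_def h_def)
    have hA: "h A = 1 + ln (card A) / \<delta>" using False by (simp add: h_def)
    \<comment> \<open>Any choice can only shrink \<open>A\<close>, so the budget never
      grows.\<close>
    have all: "real (indep_tuples E G k (A' e)) \<le> L" for e
    proof -
      have "h (A' e) \<le> h A"
      proof (cases "A' e = {}")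
        case True
        thus ?thesis using cA \<delta> False by (simp add: h_def)
      next
        case ne: False
        have "finite (A' e)" using finA sub finite_subset by blast
        hence "0 < card (A' e)" "card (A' e) \<le> card A" using ne finA sub by (auto simp: card_gt_0_iff card_mono)
        thus ?thesis using ne False \<delta> by (simp add: h_def divide_right_mono)
      qed
      hence "(1 / q) powr h (A' e) \<le> (1 / q) powr h A" using q by (intro powr_mono) auto
      hence "(2 * q * N) ^ k * (1 / q) powr h (A' e) \<le> L"
        unfolding L_def using q N by (intro mult_left_mono) auto
      with IH[of e] show ?thesis by (rule order_trans)
    qed
    \<comment> \<open>Losing a \<delta>-fraction lowers ln |A| by at least \<delta>, so the budget
      drops by one and the bound gains a factor \<open>q\<close>.\<close>
    have good: "real (indep_tuples E G k (A' e)) \<le> q * L" if e: "e \<in> X - bad" for e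
    proof -
      have "h (A' e) \<le> h A - 1"
      proof (cases "A' e = {}")
        case True
        thus ?thesis using cA \<delta> False by (simp add: h_def)
      next
        case ne: False
        have finA': "finite (A' e)" using finA sub finite_subset by blast
        have "A' e = A - {a \<in> A. G (snd e) a}" by (auto simp: A'_def)
        hence "card (A' e) = card A - card {a \<in> A. G (snd e) a}"
          using finA by (simp add: card_Diff_subset)
        moreover have "card {a \<in> A. G (snd e) a} \<le> card A" using finA by (intro card_mono) auto
        ultimately have "real (card (A' e)) = real (card A) - card {a \<in> A. G (snd e) a}" by simp
        moreover have "\<delta> * card A \<le> card {a \<in> A. G (snd e) a}" using e by (auto simp: bad_def)
        ultimately have le: "real (card (A' e)) \<le> (1 - \<delta>) * card A" by (simp add: algebra_simps)
        moreover have pos: "0 < real (card (A' e))" using ne finA' by (simp add: card_gt_0_iff)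
        ultimately have \<delta>1: "0 < 1 - \<delta>" using cA by (smt (verit) mult_nonpos_nonneg)
        have "ln (card (A' e)) \<le> ln ((1 - \<delta>) * card A)" using le pos by simp
        also have "\<dots> = ln (1 - \<delta>) + ln (card A)" using \<delta>1 cA by (simp add: ln_mult)
        also have "\<dots> \<le> ln (card A) - \<delta>" using ln_le_minus_one[OF \<delta>1] by simp
        finally have "ln (card (A' e)) / \<delta> \<le> (ln (card A) - \<delta>) / \<delta>" using \<delta> by (intro divide_right_mono) auto
        thus ?thesis using ne hA \<delta> by (simp add: h_def diff_divide_distrib)
      qed
      hence "(1 / q) powr h (A' e) \<le> (1 / q) powr (h A - 1)" using q by (intro powr_mono) auto
      also have "\<dots> = q * (1 / q) powr h A" using q by (simp add: powr_diff)
      finally have "(2 * q * N) ^ k * (1 / q) powr h (A' e) \<le> (2 * q * N) ^ k * (q * (1 / q) powr h A)"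
        using q N by (intro mult_left_mono) auto
      thus ?thesis using IH[of e] by (simp add: L_def ac_simps)
    qed
    have X: "finite X" "real (card X) \<le> N" using E by (auto simp: X_def N_def intro: card_mono)
    have badX: "bad \<subseteq> X" "real (card bad) \<le> q * N"
      using few[OF Suc.prems] by (auto simp: bad_def X_def N_def conj_assoc)
    have "real (indep_tuples E G (Suc k) A) = (\<Sum>e\<in>X. real (indep_tuples E G k (A' e)))"
      by (simp add: X_def A'_def)
    also have "\<dots> = (\<Sum>e\<in>X - bad. real (indep_tuples E G k (A' e))) + (\<Sum>e\<in>bad. real (indep_tuples E G k (A' e)))"
      by (rule sum.subset_diff[OF badX(1) X(1)])
    \<comment> \<open>At most \<open>N\<close> good choices of weight \<open>q * L\<close> and at
      most \<open>q * N\<close> bad ones of weight \<open>L\<close>: each part is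
      \<open>q * N * L\<close>, whence the 2 in the bound.\<close>
    also have "\<dots> \<le> (\<Sum>e\<in>X - bad. q * L) + (\<Sum>e\<in>bad. L)"
      by (intro add_mono sum_mono good all)
    also have "\<dots> = real (card (X - bad)) * (q * L) + real (card bad) * L" by simp
    also have "\<dots> \<le> N * (q * L) + (q * N) * L"
    proof (intro add_mono mult_right_mono)
      show "real (card (X - bad)) \<le> N" using X card_mono[of X "X - bad"] by (auto simp: of_nat_le_iff[symmetric] simp del: of_nat_le_iff)
    qed (use badX L q in auto)
    also have "\<dots> = (2 * q * N) ^ Suc k * (1 / q) powr h A" by (simp add: L_def)
    finally show ?thesis by (simp add: N_def h_def)
  qed
qed

lemma ndl_graph_card_edges:
  assumes ndl: "ndl_graph V E n d lam"
  shows "finite {(a, b). E a b}" and "card {(a, b). E a b} = n * d"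
proof -
  have fin: "finite V" and V: "card V = n" and EV: "\<And>u v. E u v \<Longrightarrow> u \<in> V \<and> v \<in> V"
    and deg: "\<And>v. v \<in> V \<Longrightarrow> card {u \<in> V. E v u} = d"
    using ndl by (auto simp: ndl_graph_def is_graph_def degree_def)
  have eq: "{(a, b). E a b} = (SIGMA a:V. {b \<in> V. E a b})" using EV by auto
  show "finite {(a, b). E a b}" unfolding eq using fin by (intro finite_SigmaI) auto
  have "card (SIGMA a:V. {b \<in> V. E a b}) = (\<Sum>a\<in>V. card {b \<in> V. E a b})"
    using fin by (intro card_SigmaI) auto
  thus "card {(a, b). E a b} = n * d" unfolding eq using V by (simp add: deg)
qed

text \<open>Exceptional pairs are \<open>F\<close>-edges between \<open>A\<close> and the set
  \<open>B\<close> of vertices with too few \<open>G\<close>-neighbours in \<open>A\<close>. Mixing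
  in \<open>G\<close> bounds |A| |B|, and then mixing in \<open>F\<close> bounds the number of these
  edges.\<close>

lemma few_exceptional_edges:
  assumes ndlF: "ndl_graph V F n dF lamF" and ndlG: "ndl_graph V G n dG lamG"
    and n: "2 \<le> n" and dF: "0 < dF" and dG: "0 < dG"
    and \<eta>1: "lamG\<^sup>2 / (real dG)\<^sup>2 \<le> \<eta>" and \<eta>2: "lamF * lamG / (real dF * real dG) \<le> \<eta>"
    and A: "A \<subseteq> V"
  shows "real (card {e \<in> {(a, b). F a b}. fst e \<in> A \<and>
      real (card {a \<in> A. G (snd e) a}) < real dG / (2 * real n) * real (card A)})
    \<le> 6 * \<eta> * real (n * dF)"
proof -
  have fin: "finite V" and V: "card V = n" and FV: "\<And>u v. F u v \<Longrightarrow> u \<in> V \<and> v \<in> V"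
    and symF: "\<And>u v. F u v \<longleftrightarrow> F v u"
    using ndlF by (auto simp: ndl_graph_def is_graph_def)
  have finA: "finite A" using A fin by (rule finite_subset)
  have n0: "0 < n" using n by simp
  have lamF: "0 \<le> lamF" and lamG: "0 \<le> lamG"
    using ndl_graph_lam_nonneg[OF ndlF n] ndl_graph_lam_nonneg[OF ndlG n] .
  define \<delta> where "\<delta> = real dG / (2 * real n)"
  have \<delta>: "0 < \<delta>" using dG n by (simp add: \<delta>_def)
  define B where "B = {b \<in> V. real (card {a \<in> A. G b a}) < \<delta> * card A}"
  have B: "B \<subseteq> V" and finB: "finite B" using fin by (auto simp: B_def)
  define r where "r = sqrt (real (card A) * real (card B))"
  have r: "0 \<le> r" and r2: "r * r = real (card A) * real (card B)" by (simp_all add: r_def)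
  have "(\<Sum>b\<in>B. real (card {a \<in> A. G b a})) \<le> (\<Sum>b\<in>B. \<delta> * card A)"
    by (intro sum_mono) (simp add: B_def)
  hence "(\<Sum>b\<in>B. real (card {a \<in> A. G b a})) \<le> \<delta> * (r * r)" by (simp add: r2 ac_simps)
  moreover have "real dG * real (card A) * real (card B) / real n = 2 * \<delta> * (r * r)"
    using n by (simp add: r2 \<delta>_def)
  \<comment> \<open>The mixing lemma predicts twice as many \<open>G\<close>-edges between
    \<open>A\<close> and \<open>B\<close> as there can be, so the deviation is at least half of the
    prediction.\<close>
  ultimately have "\<delta> * (r * r) \<le> lamG * r"
    using expander_mixing[OF ndlG n0 lamG A B] unfolding r_def[symmetric] by linarith
  hence r_le: "r \<le> lamG / \<delta>"
    using r \<delta> lamG by (cases "r = 0") (simp_all add: field_simps)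
  have "{e \<in> {(a, b). F a b}. fst e \<in> A \<and> real (card {a \<in> A. G (snd e) a}) < \<delta> * real (card A)}
      = (\<lambda>(b, a). (a, b)) ` (SIGMA b:B. {a \<in> A. F b a})"
    using FV symF by (force simp: B_def)
  moreover have "inj_on (\<lambda>(b, a). (a, b)) (SIGMA b:B. {a \<in> A. F b a})" by (auto simp: inj_on_def)
  ultimately have "card {e \<in> {(a, b). F a b}. fst e \<in> A \<and> real (card {a \<in> A. G (snd e) a}) < \<delta> * real (card A)}
      = (\<Sum>b\<in>B. card {a \<in> A. F b a})"
    using finA finB by (simp add: card_image card_SigmaI)
  hence "real (card {e \<in> {(a, b). F a b}. fst e \<in> A \<and> real (card {a \<in> A. G (snd e) a}) < \<delta> * real (card A)})
      = (\<Sum>b\<in>B. real (card {a \<in> A. F b a}))" by simp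
  also have "\<dots> \<le> real dF * (r * r) / real n + lamF * r"
    using expander_mixing[OF ndlF n0 lamF A B] unfolding r_def[symmetric] r2 by (simp add: mult.assoc)
  also have "\<dots> \<le> real dF * (lamG / \<delta> * (lamG / \<delta>)) / real n + lamF * (lamG / \<delta>)"
    using r r_le lamF by (intro add_mono divide_right_mono mult_left_mono mult_mono) auto
  \<comment> \<open>Substituting 1 / \<delta> = 2 n / d(G) gives the coefficients 4 and 2, hence the
    6.\<close>
  also have "\<dots> = (4 * (lamG\<^sup>2 / (real dG)\<^sup>2) + 2 * (lamF * lamG / (real dF * real dG))) * real (n * dF)"
    using n dF dG by (simp add: \<delta>_def power2_eq_square field_simps)
  also have "\<dots> \<le> (4 * \<eta> + 2 * \<eta>) * real (n * dF)"
    using \<eta>1 \<eta>2 by (intro mult_right_mono add_mono mult_left_mono) auto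
  finally show ?thesis by (simp add: \<delta>_def)
qed

section \<open>Numerical estimates and the lower bounds\<close>

lemma half_le_ln_2: "1 / 2 \<le> ln (2::real)"
proof -
  have "exp (1::real) \<le> 2 * 2" using exp_le by simp
  hence "1 \<le> ln (2 * 2 :: real)" by (subst ln_ge_iff) auto
  also have "\<dots> = ln 2 + ln (2::real)" by (rule ln_mult_pos) auto
  finally show ?thesis by linarith
qed

text \<open>The left side divided by \<open>fact k\<close> is one term of the exponential series at
  \<open>k\<close>.\<close>

lemma power_le_fact_mult_exp:
  shows "real k ^ k \<le> fact k * exp 1 ^ k"
proof -
  have "(\<Sum>n\<in>{k}. inverse (fact n) *\<^sub>R real k ^ n) \<le> (\<Sum>n. inverse (fact n) *\<^sub>R real k ^ n)"
    using summable_exp_generic[of "real k"] by (intro sum_le_suminf) auto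
  hence "real k ^ k / fact k \<le> exp (real k)" by (simp add: exp_def divide_inverse ac_simps)
  also have "exp (real k) = exp 1 ^ k" by (simp add: exp_of_nat_mult[symmetric])
  finally show ?thesis by (simp add: pos_divide_le_eq ac_simps)
qed

text \<open>The constant \<open>50\<close> enters here, through \<open>12 * e < 50\<close>.\<close>
lemma binomial_mult_lt_1:
  fixes \<eta> w :: real
  assumes k: "0 < k" and \<eta>: "0 < \<eta>" and M: "real M \<le> real k / 50 * \<eta> powr ((w - real k) / real k)"
  shows "real (M choose k) * (12 ^ k * \<eta> powr (real k - w)) < 1"
proof -
  define z where "z = \<eta> powr ((w - real k) / real k)"
  have z: "0 < z" using \<eta> by (simp add: z_def)
  \<comment> \<open>The size of \<open>M\<close> is chosen for this cancellation.\<close>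
  have zk: "z ^ k * \<eta> powr (real k - w) = 1"
    using k \<eta> by (simp add: z_def powr_power powr_add[symmetric])
  have "exp 1 * z / 50 * 12 = 12 * exp 1 / 50 * z" by simp
  hence split: "(exp 1 * z / 50) ^ k * 12 ^ k = (12 * exp 1 / 50) ^ k * z ^ k"
    by (metis power_mult_distrib)
  have "(M choose k) * fact k \<le> M ^ k" by (rule binomial_fact_pow)
  hence "real ((M choose k) * fact k) \<le> real (M ^ k)" by (simp only: of_nat_le_iff)
  hence "real (M choose k) * fact k \<le> real M ^ k" by simp
  also have "\<dots> \<le> (real k / 50 * z) ^ k" using M by (intro power_mono) (auto simp: z_def)
  also have "\<dots> = real k ^ k * (z / 50) ^ k" by (simp add: power_mult_distrib power_divide)
  also have "\<dots> \<le> (fact k * exp 1 ^ k) * (z / 50) ^ k"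
    using z by (intro mult_right_mono power_le_fact_mult_exp) auto
  finally have "fact k * real (M choose k) \<le> fact k * (exp 1 * z / 50) ^ k"
    by (simp add: power_mult_distrib power_divide ac_simps)
  hence "real (M choose k) \<le> (exp 1 * z / 50) ^ k" by simp
  hence "real (M choose k) * (12 ^ k * \<eta> powr (real k - w)) \<le> (exp 1 * z / 50) ^ k * (12 ^ k * \<eta> powr (real k - w))"
    by (rule mult_right_mono) simp
  also have "\<dots> = (12 * exp 1 / 50) ^ k * (z ^ k * \<eta> powr (real k - w))"
    by (simp only: mult.assoc[symmetric] split)
  also have "\<dots> = (12 * exp 1 / 50) ^ k" by (simp add: zk)
  also have "\<dots> < 1 ^ k"
  proof (rule power_strict_mono)
    \<comment> \<open>12 * 3 / 50 = 36 / 50 is below 1.\<close>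
    have "exp (1::real) \<le> 3" by (rule exp_le)
    thus "12 * exp (1::real) / 50 < 1" by simp
  qed (use k in auto)
  finally show ?thesis by simp
qed

text \<open>Combines the tuple count, at density \<open>q\<close> and budget \<open>h\<close>, with
  the first moment method for \<open>M\<close> random pairs.\<close>

lemma ramsey_number_ge_if_le_1:
  assumes ndlF: "ndl_graph V F n dF lamF" and ndlG: "ndl_graph V G n dG lamG"
    and free: "Hs_free s V F G"
    and n: "2 \<le> n" and dF: "0 < dF" and dG: "0 < dG" and k: "0 < k"
    and \<eta>1: "lamG\<^sup>2 / (real dG)\<^sup>2 \<le> \<eta>" and \<eta>2: "lamF * lamG / (real dF * real dG) \<le> \<eta>"
    and \<eta>: "0 < \<eta>" "\<eta> \<le> 1"
    and w: "w = 4 * real n * ln (real n) / real dG" and wk: "w \<le> real k"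
  shows "real k / 50 * \<eta> powr ((w - real k) / real k) \<le> real (ramsey_number s k)"
proof -
  define E where "E = {(a, b). F a b}"
  define N where "N = real (card E)"
  \<comment> \<open>\<open>6 * \<eta>\<close> may exceed 1, but the tuple bound requires
    \<open>q\<close> at most 1; the proportion of exceptional edges is at most 1 anyway.\<close>
  define q where "q = min (6 * \<eta>) 1"
  define \<delta> where "\<delta> = real dG / (2 * real n)"
  define M where "M = nat \<lfloor>real k / 50 * \<eta> powr ((w - real k) / real k)\<rfloor>"
  have fin: "finite V" and V: "card V = n" and FV: "\<And>u v. F u v \<Longrightarrow> u \<in> V \<and> v \<in> V"
    using ndlF by (auto simp: ndl_graph_def is_graph_def)
  have symG: "\<And>u v. G u v \<Longrightarrow> G v u" using ndlG by (auto simp: ndl_graph_def is_graph_def)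
  have finE: "finite E" and cardE: "card E = n * dF"
    unfolding E_def using ndl_graph_card_edges[OF ndlF] .
  have Ene: "E \<noteq> {}" using cardE n dF by auto
  have N: "0 < N" using cardE n dF by (simp add: N_def)
  have q: "0 < q" "q \<le> 1" "q \<le> 6 * \<eta>" using \<eta> by (auto simp: q_def)
  have \<delta>: "0 < \<delta>" using dG n by (simp add: \<delta>_def)
  have Vne: "V \<noteq> {}" using V n by auto
  have few: "real (card {e \<in> E. fst e \<in> A \<and> real (card {a \<in> A. G (snd e) a}) < \<delta> * card A}) \<le> q * card E"
    if "A \<subseteq> V" for A
  proof -
    let ?X = "{e \<in> E. fst e \<in> A \<and> real (card {a \<in> A. G (snd e) a}) < \<delta> * card A}"
    have "real (card ?X) \<le> 6 * \<eta> * card E"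
      unfolding cardE \<delta>_def unfolding E_def
      by (rule few_exceptional_edges[OF ndlF ndlG n dF dG \<eta>1 \<eta>2 that])
    moreover have "card ?X \<le> card E" using finE by (intro card_mono) auto
    ultimately show ?thesis by (simp add: q_def min_def)
  qed
  define h where "h = 1 + ln (card V) / \<delta>"
  have "real (indep_tuples E G k V) \<le> (2 * q * N) ^ k * (1 / q) powr h"
    using indep_tuples_le[OF fin finE q(1,2) \<delta> few order.refl, of k] Vne by (simp add: N_def h_def)
  also have "\<dots> = (2 * N) ^ k * (q powr k * (1 / q) powr h)"
    using q by (simp add: power_mult_distrib powr_realpow ac_simps)
  also have "q powr k * (1 / q) powr h = q powr (k - h)"
    using q by (simp add: powr_divide powr_diff)
  \<comment> \<open>The budget \<open>h\<close> is at most \<open>w\<close>: \<open>w\<close> is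
    twice ln n / \<delta>, and one of the two copies covers the summand 1 because d(G) is at most
    n.\<close>
  also have "q powr (k - h) \<le> q powr (k - w)"
  proof (rule powr_mono')
    have dGn: "dG \<le> n"
    proof -
      obtain v where "v \<in> V" using Vne by blast
      hence "dG = card {u \<in> V. G v u}" using ndlG by (simp add: ndl_graph_def degree_def)
      also have "\<dots> \<le> card V" using fin by (intro card_mono) auto
      finally show ?thesis using V by simp
    qed
    have "real dG \<le> real n" using dGn by simp
    also have "\<dots> \<le> real n * (2 * ln (real n))"
    proof -
      have "1 \<le> 2 * ln (2::real)" using half_le_ln_2 by simp
      also have "\<dots> \<le> 2 * ln (real n)" using n by simp
      finally show ?thesis using n by simp
    qed
    finally have "1 \<le> ln (real n) / \<delta>" using dG n by (simp add: \<delta>_def pos_le_divide_eq ac_simps)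
    moreover have "w = ln (real n) / \<delta> + ln (real n) / \<delta>" unfolding w \<delta>_def by simp
    ultimately show "k - w \<le> k - h" unfolding h_def V by linarith
  qed (use q in auto)
  \<comment> \<open>The exponent is nonnegative as \<open>w\<close> is at most \<open>k\<close>, so
    \<open>q\<close> may be replaced by \<open>6 * \<eta>\<close>; with the earlier 2 this makes the
    12.\<close>
  also have "q powr (k - w) \<le> 6 ^ k * \<eta> powr (k - w)"
  proof -
    have "0 \<le> w" using n by (simp add: w)
    have "q powr (k - w) \<le> (6 * \<eta>) powr (k - w)" using q wk by (intro powr_mono2) auto
    also have "\<dots> = 6 powr (k - w) * \<eta> powr (k - w)" using \<eta> by (simp add: powr_mult)
    also have "\<dots> \<le> 6 powr k * \<eta> powr (k - w)"
      using \<open>0 \<le> w\<close> by (intro mult_right_mono powr_mono) auto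
    finally show ?thesis by (simp add: powr_realpow)
  qed
  finally have tup: "real (indep_tuples E G k V) \<le> (2 * N) ^ k * (6 ^ k * \<eta> powr (k - w))"
    using N by (simp add: mult_left_mono)
  have M: "real M \<le> real k / 50 * \<eta> powr ((w - real k) / real k)"
    unfolding M_def by (rule of_nat_floor) simp
  have "2 * N * 6 = N * 12" by simp
  hence "(2 * N) ^ k * 6 ^ k = N ^ k * 12 ^ k" by (metis power_mult_distrib)
  hence split: "c * (2 * N) ^ k * 6 ^ k = c * N ^ k * 12 ^ k" for c by (simp only: mult.assoc)
  have "real (M choose k) * real (indep_tuples E G k V)
      \<le> real (M choose k) * ((2 * N) ^ k * (6 ^ k * \<eta> powr (k - w)))"
    using tup by (rule mult_left_mono) simp
  also have "\<dots> = N ^ k * (real (M choose k) * (12 ^ k * \<eta> powr (k - w)))"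
    by (simp only: mult.assoc[symmetric] split) (simp only: ac_simps)
  also have "\<dots> < N ^ k * 1"
    using binomial_mult_lt_1[OF k \<eta>(1) M] N by (intro mult_strict_left_mono) auto
  finally have "real ((M choose k) * indep_tuples E G k V) < real (card E ^ k)" by (simp add: N_def)
  hence "(M choose k) * indep_tuples E G k V < card E ^ k" by (simp only: of_nat_less_iff)
  then obtain f where f: "f \<in> {..<M} \<rightarrow>\<^sub>E E" "indep_sets G M k V f = {}"
    using exists_indep_sets_empty[OF finE Ene] by blast
  have "\<not> ramsey_prop s k M"
    by (rule not_ramsey_prop_of_indep_sets_empty[OF free symG _ f]) (use FV in \<open>auto simp: E_def\<close>)
  \<comment> \<open>The strict inequality absorbs the rounding in \<open>M\<close>.\<close>
  hence "M < ramsey_number s k" by (rule less_ramsey_number)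
  thus ?thesis unfolding M_def by linarith
qed

theorem theorem2p9:
  fixes V :: "'a set" and F G :: "'a \<Rightarrow> 'a \<Rightarrow> bool"
    and s n dF dG :: nat and lamF lamG :: real
  assumes "s \<ge> 3"
    and "ndl_graph V F n dF lamF"
    and "ndl_graph V G n dG lamG"
    and "Hs_free s V F G"
  defines "\<eta> \<equiv> max (lamG\<^sup>2 / (real dG)\<^sup>2) (lamF * lamG / (real dF * real dG))"
    and "w \<equiv> 4 * real n * ln (real n) / real dG"
  shows "(\<forall>k :: nat. k > 0 \<longrightarrow> w \<le> real k \<longrightarrow> real k \<le> \<eta> * real dF * real n \<longrightarrow>
            real (ramsey_number s k) \<ge> 1 / 50 * real k * \<eta> powr ((w - real k) / real k) - 1)
       \<and> (\<forall>k :: nat. k > 0 \<longrightarrow> 100 * real n * (ln (real n))\<^sup>2 / real dG \<le> real k \<longrightarrow>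
            real k \<le> \<eta> * real dF * real n \<longrightarrow>
            real (ramsey_number s k) \<ge> real k / (100 * \<eta>) - 1)"
proof -
  have nondeg: "2 \<le> n \<and> 0 < dF \<and> 0 < dG \<and> 0 < \<eta>" if k: "0 < k" and kN: "real k \<le> \<eta> * real dF * real n" for k
  proof -
    have pos: "0 < \<eta> * real dF * real n" using k kN by linarith
    have "0 \<le> \<eta>" unfolding \<eta>_def by (simp add: le_max_iff_disj)
    with pos have \<eta>: "0 < \<eta>" by (cases "\<eta> = 0") auto
    have dF: "0 < dF" and n: "0 < n" using pos by (auto intro!: Nat.gr0I)
    \<comment> \<open>For d(G) = 0 both quotients are 0 by the convention on division, contradicting
      0 < \<eta>.\<close>
    have dG: "0 < dG" using \<eta> by (intro Nat.gr0I) (auto simp: \<eta>_def)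
    \<comment> \<open>On a single vertex both graphs would be a loop, and the constant tuple is a
      copy of H_s.\<close>
    have "n \<noteq> 1"
    proof
      assume "n = 1"
      then obtain v where V: "V = {v}" using assms(2) by (auto simp: ndl_graph_def card_1_singleton_iff)
      have "{u \<in> V. F v u} \<noteq> {}" "{u \<in> V. G v u} \<noteq> {}"
        using assms(2,3) dF dG V by (auto simp: ndl_graph_def degree_def card_gt_0_iff)
      hence "F v v" "G v v" using V by auto
      thus False using assms(4) V unfolding Hs_free_def by (auto dest!: spec[of _ "\<lambda>_. v"])
    qed
    thus ?thesis using \<eta> dF dG n by linarith
  qed
  have \<eta>1: "lamG\<^sup>2 / (real dG)\<^sup>2 \<le> \<eta>" and \<eta>2: "lamF * lamG / (real dF * real dG) \<le> \<eta>"
    by (simp_all add: \<eta>_def)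
  have triv: "real k \<le> real (ramsey_number s k)" if "0 < k" for k
    using le_ramsey_number[of s k] assms(1) that by simp
  have main: "real k / 50 * \<eta> powr ((w - real k) / real k) \<le> real (ramsey_number s k)"
    if k: "0 < k" and wk: "w \<le> real k" and kN: "real k \<le> \<eta> * real dF * real n" for k
  proof (cases "\<eta> \<le> 1")
    case True
    thus ?thesis
      using ramsey_number_ge_if_le_1[OF assms(2,3,4) _ _ _ k \<eta>1 \<eta>2 _ True _ wk] nondeg[OF k kN]
      by (simp add: w_def)
  next
    case False
    \<comment> \<open>For \<eta> > 1 the exponent is at most 0, so the claimed bound is below the
      trivial bound \<open>k\<close>.\<close>
    have "\<eta> powr ((w - real k) / real k) \<le> \<eta> powr 0"
      using False wk k by (intro powr_mono) (auto simp: divide_nonpos_pos)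
    hence "real k / 50 * \<eta> powr ((w - real k) / real k) \<le> real k / 50 * 1"
      using False by (intro mult_left_mono) auto
    thus ?thesis using triv[OF k] by simp
  qed
  have second: "real k / (100 * \<eta>) \<le> real (ramsey_number s k)"
    if k: "0 < k" and k100: "100 * real n * (ln (real n))\<^sup>2 / real dG \<le> real k"
      and kN: "real k \<le> \<eta> * real dF * real n" for k
  proof (cases "\<eta> \<le> 1")
    case False
    have "real k / (100 * \<eta>) \<le> real k / 1" using False by (intro divide_left_mono) auto
    thus ?thesis using triv[OF k] by simp
  next
    case True
    have n: "2 \<le> n" and dF: "0 < dF" and dG: "0 < dG" and \<eta>: "0 < \<eta>" using nondeg[OF k kN] by auto
    define l where "l = ln (real n)"
    have l: "1 / 2 \<le> l"
    proof -
      have "ln 2 \<le> l" using n by (simp add: l_def)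
      thus ?thesis using half_le_ln_2 by linarith
    qed
    have w0: "0 < w" using n dG by (simp add: w_def)
    have k100': "25 * l * w \<le> real k" using k100 by (simp add: w_def l_def power2_eq_square ac_simps)
    have "w * 1 \<le> w * (25 * l)" using l w0 by (intro mult_left_mono) auto
    hence wk: "w \<le> real k" using k100' by (simp add: ac_simps)
    \<comment> \<open>Since 1 \<le> \<open>k\<close> \<le> \<eta> d(F) n and d(F) \<le> n, \<eta> is
      at least 1 / n^2, so ln \<eta> is at least \<open>- 2 * l\<close>.\<close>
    have "\<eta> * (real n * real n) \<ge> 1"
    proof -
      have "V \<noteq> {}" using n assms(2) by (auto simp: ndl_graph_def)
      then obtain v where "v \<in> V" by blast
      hence "dF = card {u \<in> V. F v u}" using assms(2) by (simp add: ndl_graph_def degree_def)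
      also have "\<dots> \<le> card V" using assms(2) by (intro card_mono) (auto simp: ndl_graph_def is_graph_def)
      finally have "dF \<le> n" using assms(2) by (simp add: ndl_graph_def)
      hence "\<eta> * real dF * real n \<le> \<eta> * real n * real n" using \<eta> by (intro mult_right_mono mult_left_mono) auto
      moreover have "1 \<le> real k" using k by simp
      ultimately show ?thesis using kN by (simp add: mult.assoc)
    qed
    hence "0 \<le> ln (\<eta> * (real n * real n))" by simp
    also have "\<dots> = ln \<eta> + 2 * l" using \<eta> n by (simp add: ln_mult l_def)
    finally have ln\<eta>: "- 2 * l \<le> ln \<eta>" by simp
    \<comment> \<open>\<open>w / k\<close> is at most 1 / (25 l), so \<eta>^(w / k) is at least exp
      (- 2 / 25), which exceeds 1/2; this loss of a factor 2 turns 50 into 100.\<close>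
    have "- (2 / 25) \<le> w / real k * ln \<eta>"
    proof -
      have "w / real k * (2 * l) \<le> 2 / 25" using k100' k by (simp add: pos_divide_le_eq ac_simps)
      moreover have "w / real k * (- 2 * l) \<le> w / real k * ln \<eta>"
        using ln\<eta> w0 k by (intro mult_left_mono) auto
      ultimately show ?thesis by simp
    qed
    moreover have "- ln 2 \<le> (- (2 / 25) :: real)" using half_le_ln_2 by simp
    ultimately have "- ln 2 \<le> w / real k * ln \<eta>" by (rule order_trans[rotated])
    hence "exp (- ln 2) \<le> exp (w / real k * ln \<eta>)" by (simp only: exp_le_cancel_iff)
    moreover have "exp (- ln 2) = (1 / 2 :: real)" by (simp add: exp_minus)
    moreover have "exp (w / real k * ln \<eta>) = \<eta> powr (w / real k)" using \<eta> by (simp add: powr_def)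
    ultimately have half: "1 / 2 \<le> \<eta> powr (w / real k)" by (simp only:)
    have "(w - real k) / real k = w / real k - 1" using k by (simp add: diff_divide_distrib)
    hence pw: "\<eta> powr ((w - real k) / real k) = \<eta> powr (w / real k) / \<eta>"
      using \<eta> by (simp add: powr_diff)
    have "real k / (100 * \<eta>) = real k / 50 * (1 / 2 / \<eta>)" by simp
    also have "\<dots> \<le> real k / 50 * (\<eta> powr (w / real k) / \<eta>)"
      using half \<eta> by (intro mult_left_mono divide_right_mono) auto
    also have "\<dots> \<le> real (ramsey_number s k)" using main[OF k wk kN] unfolding pw .
    finally show ?thesis .
  qed
  show ?thesis
  proof (intro conjI allI impI)
    fix k assume "0 < k" "w \<le> real k" "real k \<le> \<eta> * real dF * real n"
    from main[OF this] show "1 / 50 * real k * \<eta> powr ((w - real k) / real k) - 1 \<le> real (ramsey_number s k)"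
      by simp
  next
    fix k assume "0 < k" "100 * real n * (ln (real n))\<^sup>2 / real dG \<le> real k" "real k \<le> \<eta> * real dF * real n"
    from second[OF this] show "real k / (100 * \<eta>) - 1 \<le> real (ramsey_number s k)" by simp
  qed
qed

end
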